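(* Let $k\ge2$ and $n\ge2k$ be integers and let $\lambda\in\{\rho,q\}$. For the relevant integers $s$ put $R_{n,s}=K_{s+1}\vee(sK_1\cup K_{n-2s-1})$. Then $$\mathrm{spex}_\lambda(n,\mathsf{HC};\delta\ge k)=\max_{k-1\le s\le\lfloor n/2\rfloor-1}\lambda(R_{n,s}),$$ and $$\mathrm{SPEX}_\lambda(n,\mathsf{HC};\delta\ge k)=\left\{R_{n,s}: k-1\le s\le\lfloor n/2\rfloor-1,\ \lambda(R_{n,s})=\mathrm{spex}_\lambda(n,\mathsf{HC};\delta\ge k)\right\}.$$
   Context: All graphs are finite and simple; graph equality is up to isomorphism. $H_1\cup H_2$ denotes disjoint union and $H_1\vee H_2$ denotes join (disjoint union plus all edges between the two graphs); $sK_1$ is the edgeless graph on $s$ vertices. $\delta$ is the minimum degree. A graph is Hamiltonian-connected (also: Hamilton-connected) if every pair of distinct vertices is joined by a Hamilton path; $\mathsf{HC}$ denotes this property. With $A(G)$ the adjacency matrix and $D(G)$ the diagonal degree matrix of $G$, $\rho(G)$ is the largest eigenvalue of $A(G)$ (spectral radius) and $q(G)$ is the largest eigenvalue of $Q(G)=D(G)+A(G)$ (signless Laplacian spectral radius). For $\lambda\in\{\rho,q\}$, $\mathrm{spex}_\lambda(n,\mathsf{HC};\delta\ge k)$ is the maximum of $\lambda$ over all graphs of order $n$ and minimum degree at least $k$ that are not Hamiltonian-connected, and $\mathrm{SPEX}_\lambda(n,\mathsf{HC};\delta\ge k)$ is the family of all such graphs (up to isomorphism) attaining this maximum. *)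

theory Defs
  imports "Graph_Theory.Graph_Theory" "Jordan_Normal_Form.Spectral_Radius"
begin

text \<open>
  A finite simple graph is a \<^const>\<open>pair_graph\<close>: a finite, symmetric, loopfree digraph without
  parallel arcs, every edge being represented by its two arcs.  Graphs of order \<open>n\<close> are
  represented on the standard vertex set \<open>{0..<n}\<close>; this loses nothing, since every graph of
  order \<open>n\<close> is isomorphic to one of these.  All definitions below that mention \<open>card (pverts G)\<close>
  are meant for such graphs.
\<close>

definition graphs_of_order :: "nat \<Rightarrow> nat pair_pre_digraph set" where
  "graphs_of_order n = {G. pair_graph G \<and> pverts G = {0..<n}}"

definition complete_graph :: "nat \<Rightarrow> nat pair_pre_digraph" where
  "complete_graph n = \<lparr>pverts = {0..<n}, parcs = {(u, v). u < n \<and> v < n \<and> u \<noteq> v}\<rparr>"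

definition empty_graph :: "nat \<Rightarrow> nat pair_pre_digraph" where
  "empty_graph n = \<lparr>pverts = {0..<n}, parcs = {}\<rparr>"

text \<open>
  In a disjoint union and in a join, the vertices of the second graph are shifted by the order
  of the first, so that standard vertex sets are again obtained.
\<close>

definition shift_graph :: "nat \<Rightarrow> nat pair_pre_digraph \<Rightarrow> nat pair_pre_digraph" where
  "shift_graph m G = \<lparr>pverts = (\<lambda>v. m + v) ` pverts G,
                      parcs = (\<lambda>(u, v). (m + u, m + v)) ` parcs G\<rparr>"

definition disjoint_union_graph ::
    "nat pair_pre_digraph \<Rightarrow> nat pair_pre_digraph \<Rightarrow> nat pair_pre_digraph" where
  "disjoint_union_graph G H =
    (let H' = shift_graph (card (pverts G)) H
     in \<lparr>pverts = pverts G \<union> pverts H', parcs = parcs G \<union> parcs H'\<rparr>)"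

definition join_graph ::
    "nat pair_pre_digraph \<Rightarrow> nat pair_pre_digraph \<Rightarrow> nat pair_pre_digraph" where
  "join_graph G H =
    (let H' = shift_graph (card (pverts G)) H
     in \<lparr>pverts = pverts G \<union> pverts H',
         parcs = parcs G \<union> parcs H' \<union> pverts G \<times> pverts H' \<union> pverts H' \<times> pverts G\<rparr>)"

definition R_graph :: "nat \<Rightarrow> nat \<Rightarrow> nat pair_pre_digraph" where
  "R_graph n s = join_graph (complete_graph (s + 1))
                   (disjoint_union_graph (empty_graph s) (complete_graph (n - 2 * s - 1)))"

text \<open>As graphs are symmetric digraphs, the degree of a vertex is its out-degree.\<close>

definition min_degree :: "nat pair_pre_digraph \<Rightarrow> nat" where
  "min_degree G = Min (out_degree (with_proj G) ` pverts G)"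

definition hamiltonian_connected :: "nat pair_pre_digraph \<Rightarrow> bool" where
  "hamiltonian_connected G \<longleftrightarrow>
    (\<forall>u\<in>pverts G. \<forall>v\<in>pverts G. u \<noteq> v \<longrightarrow>
      (\<exists>p. vpath p (with_proj G) \<and> hd p = u \<and> last p = v \<and> set p = pverts G))"

definition adjacency_matrix :: "nat pair_pre_digraph \<Rightarrow> real mat" where
  "adjacency_matrix G = mat (card (pverts G)) (card (pverts G))
     (\<lambda>(i, j). if (i, j) \<in> parcs G then 1 else 0)"

definition degree_matrix :: "nat pair_pre_digraph \<Rightarrow> real mat" where
  "degree_matrix G = mat (card (pverts G)) (card (pverts G))
     (\<lambda>(i, j). if i = j then real (out_degree (with_proj G) i) else 0)"

text \<open>
  The matrices below are real and symmetric, so all their eigenvalues are real and the real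
  spectrum, which is all that \<^const>\<open>spectrum\<close> sees for a real matrix, is the whole spectrum.
\<close>

definition largest_eigenvalue :: "real mat \<Rightarrow> real" where
  "largest_eigenvalue A = Max (spectrum A)"

definition adjacency_radius :: "nat pair_pre_digraph \<Rightarrow> real" where
  "adjacency_radius G = largest_eigenvalue (adjacency_matrix G)"

definition signless_laplacian_radius :: "nat pair_pre_digraph \<Rightarrow> real" where
  "signless_laplacian_radius G = largest_eigenvalue (degree_matrix G + adjacency_matrix G)"

definition non_property_graphs ::
    "nat \<Rightarrow> (nat pair_pre_digraph \<Rightarrow> bool) \<Rightarrow> nat \<Rightarrow> nat pair_pre_digraph set" where
  "non_property_graphs n P k = {G \<in> graphs_of_order n. k \<le> min_degree G \<and> \<not> P G}"

definition spex ::
    "(nat pair_pre_digraph \<Rightarrow> real) \<Rightarrow> nat \<Rightarrow> (nat pair_pre_digraph \<Rightarrow> bool) \<Rightarrow> nat \<Rightarrow> real" where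
  "spex lam n P k = Max (lam ` non_property_graphs n P k)"

text \<open>
  A graph up to isomorphism is the set of all standard graphs isomorphic to it; a family of
  graphs up to isomorphism is a set of such classes.
\<close>

definition iso_class :: "nat pair_pre_digraph \<Rightarrow> nat pair_pre_digraph set" where
  "iso_class G = {H \<in> graphs_of_order (card (pverts G)). digraph_iso (with_proj G) (with_proj H)}"

definition SPEX ::
    "(nat pair_pre_digraph \<Rightarrow> real) \<Rightarrow> nat \<Rightarrow> (nat pair_pre_digraph \<Rightarrow> bool) \<Rightarrow> nat
      \<Rightarrow> nat pair_pre_digraph set set" where
  "SPEX lam n P k = iso_class ` {G \<in> non_property_graphs n P k. lam G = spex lam n P k}"

end

theory Submission
  imports Defs
begin

text \<open>
  Fix two vertices not joined by a Hamilton path.  The rotation argument of Bondy and Chvatal shows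
  that adding an edge between non-adjacent vertices of degree sum larger than \<open>n\<close> creates no such
  path, so one may assume that non-adjacent vertices have degree sum at most \<open>n\<close>.  A non-adjacent
  pair of maximal degree sum then yields an \<open>s\<close> such that at least \<open>s\<close> vertices have degree at most
  \<open>s + 1\<close> and at least \<open>n - s - 1\<close> have degree at most \<open>n - s - 1\<close>: the degree sequence is dominated
  by that of \<open>R\<^sub>n\<^sub>,\<^sub>s\<close>.

  Both spectral radii are handled as the largest eigenvalue of \<open>t D + A\<close> with \<open>t \<in> {0, 1}\<close>.  The
  positive eigenvector \<open>f\<close> of \<open>R\<^sub>n\<^sub>,\<^sub>s\<close> increases along the neighbourhood order of this threshold
  graph.  Transplanted to \<open>G\<close> along the degree order, it satisfies \<open>(t D + A) f \<le> \<rho> f\<close>, because a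
  vertex of \<open>R\<^sub>n\<^sub>,\<^sub>s\<close> is joined to the vertices of largest weight.  Pairing with the absolute value of
  an eigenvector of \<open>G\<close> bounds its eigenvalues by \<open>\<rho>\<close>, and equality forces the neighbourhoods to agree
  on the support of that eigenvector, which then is everything.
\<close>

section \<open>Hamilton paths and degrees\<close>

text \<open>Vertex set and arc relation are separate arguments, so that an edge is added by a plain
  \<open>insert\<close>, without rebuilding a graph record.\<close>

definition hamilton_path :: "'a set \<Rightarrow> 'a rel \<Rightarrow> 'a \<Rightarrow> 'a \<Rightarrow> 'a list \<Rightarrow> bool" where
  "hamilton_path V E x y p \<longleftrightarrow> p \<noteq> [] \<and> distinct p \<and> set p = V \<and> hd p = x \<and> last p = y
     \<and> successively (\<lambda>a b. (a, b) \<in> E) p"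

section \<open>Rotations and the degree sum across a missing edge\<close>

lemma successively_rev_sym:
  assumes "sym E"
  shows "successively (\<lambda>a b. (a, b) \<in> E) (rev p) \<longleftrightarrow> successively (\<lambda>a b. (a, b) \<in> E) p"
  using assms by (auto simp: sym_def intro: successively_mono)

lemma split_nth_pair:
  assumes "Suc j < length p"
  shows "p = take j p @ p ! j # p ! Suc j # drop (Suc (Suc j)) p"
  using assms by (metis Cons_nth_drop_Suc Suc_lessD append_take_drop_id)

text \<open>Reversing the segment from \<open>b\<close> to \<open>u\<close> trades the steps
  \<open>a\<close>-\<open>b\<close> and \<open>u\<close>-\<open>v\<close> for
  \<open>a\<close>-\<open>u\<close> and \<open>b\<close>-\<open>v\<close>. The segment contains
  neither the first nor the last vertex of the path, so the ends \<open>x\<close> and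
  \<open>y\<close> stay in place.\<close>

lemma hamilton_path_rotate_left:
  assumes "sym E"
    and "hamilton_path V (insert (u, v) (insert (v, u) E)) x y (ps @ a # b # qs @ u # v # ys)"
    and "successively (\<lambda>a b. (a, b) \<in> E) (ps @ a # b # qs @ [u])"
    and "successively (\<lambda>a b. (a, b) \<in> E) (v # ys)"
    and "(u, a) \<in> E" "(v, b) \<in> E"
  shows "hamilton_path V E x y (ps @ a # u # rev qs @ b # v # ys)"
proof -
  have "successively (\<lambda>a b. (a, b) \<in> E) (b # qs @ [u])"
    using assms(3) by (auto simp: successively_append_iff)
  hence "successively (\<lambda>a b. (a, b) \<in> E) (rev (b # qs @ [u]))"
    using successively_rev_sym[OF assms(1)] by blast
  hence 1: "successively (\<lambda>a b. (a, b) \<in> E) (u # rev qs @ [b])" by simp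
  have "successively (\<lambda>a b. (a, b) \<in> E) ((ps @ [a]) @ (u # rev qs @ [b]) @ (v # ys))"
    using 1 assms(3,4) symD[OF assms(1) assms(5)] symD[OF assms(1) assms(6)]
    unfolding successively_append_iff by (auto simp: successively_append_iff)
  thus ?thesis
    using assms(2) unfolding hamilton_path_def by (auto simp: hd_append)
qed

text \<open>The mirror case, where the reversed segment \<open>ws\<close> starts at
  \<open>v\<close>: the steps from \<open>u\<close> to \<open>v\<close> and from
  \<open>last ws\<close> to \<open>b\<close> become \<open>u\<close> to \<open>last ws\<close> and
  \<open>v\<close> to \<open>b\<close>.\<close>

lemma hamilton_path_rotate_right:
  assumes "sym E"
    and "hamilton_path V (insert (u, v) (insert (v, u) E)) x y (xs @ u # ws @ b # qs)"
    and "ws \<noteq> []" "hd ws = v"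
    and "successively (\<lambda>a b. (a, b) \<in> E) (xs @ [u])"
    and "successively (\<lambda>a b. (a, b) \<in> E) (ws @ b # qs)"
    and "(u, last ws) \<in> E" "(v, b) \<in> E"
  shows "hamilton_path V E x y (xs @ u # rev ws @ b # qs)"
proof -
  have "successively (\<lambda>a b. (a, b) \<in> E) ws"
    using assms(6) by (auto simp: successively_append_iff)
  hence 1: "successively (\<lambda>a b. (a, b) \<in> E) (rev ws)"
    using successively_rev_sym[OF assms(1)] by blast
  have "successively (\<lambda>a b. (a, b) \<in> E) ((xs @ [u]) @ rev ws @ (b # qs))"
    using 1 assms(3-8)
    unfolding successively_append_iff by (auto simp: successively_append_iff hd_rev last_rev)
  thus ?thesis
    using assms(2) unfolding hamilton_path_def by (auto simp: hd_append)
qed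

text \<open>Record a neighbour of \<open>u\<close> by its position and a neighbour of
  \<open>v\<close> by the position of its predecessor. A position recorded twice would allow a
  rotation that removes the step \<open>u\<close>-\<open>v\<close>, so the two sets of positions
  \<open>A\<close> and \<open>B\<close> are disjoint.\<close>

lemma crossing_degree_sum:
  assumes "sym E" "E \<subseteq> V \<times> V" "(u, u) \<notin> E" "(v, v) \<notin> E" "(u, v) \<notin> E"
    and ham: "hamilton_path V (insert (u, v) (insert (v, u) E)) x y (xs @ u # v # ys)"
    and left: "successively (\<lambda>a b. (a, b) \<in> E) (xs @ [u])"
    and right: "successively (\<lambda>a b. (a, b) \<in> E) (v # ys)"
    and none: "\<nexists>p. hamilton_path V E x y p"
  shows "card (E `` {u}) + card (E `` {v}) \<le> card V"
proof -
  define p where "p = xs @ u # v # ys"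
  define i where "i = length xs"
  define n where "n = length p"
  have dist: "distinct p" and set: "set p = V"
    using ham by (auto simp: hamilton_path_def p_def)
  have card: "card V = n" using distinct_card[OF dist] set n_def by simp
  have n2: "Suc i < n" by (simp add: n_def p_def i_def)
  define A where "A = {j. Suc j < n \<and> (u, p ! j) \<in> E}"
  define B where "B = {j. Suc j < n \<and> (v, p ! Suc j) \<in> E}"
  have finA: "finite A" and finB: "finite B"
    unfolding A_def B_def by (rule finite_subset[of _ "{..<n}"], auto)+
  have pu: "p ! i = u" and pv: "p ! Suc i = v" by (simp_all add: p_def i_def nth_append)
  \<comment> \<open>Position \<open>i\<close> holds \<open>u\<close> and its successor is
    \<open>v\<close>, so a membership would be a loop.\<close>
  have iA: "i \<notin> A" and iB: "i \<notin> B" using assms(3,4) by (auto simp: A_def B_def pu pv)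
  have disj: "j \<notin> B" if "j \<in> A" for j
  proof
    assume "j \<in> B"
    with that have j: "Suc j < n" and ju: "(u, p ! j) \<in> E" and jv: "(v, p ! Suc j) \<in> E"
      by (auto simp: A_def B_def)
    have "j \<noteq> i" using that iA by auto
    then consider "j < i" | "i < j" by linarith
    thus False
    proof cases
      case 1
      define ps where "ps = take j xs"
      define a where "a = p ! j"
      define b where "b = p ! Suc j"
      show False
      proof (cases "Suc j = i")
        \<comment> \<open>The segment to be reversed would be \<open>u\<close> alone; here
          \<open>b = u\<close>, and \<open>jv\<close> contradicts the non-adjacency of
          \<open>u\<close> and \<open>v\<close>.\<close>
        case True
        hence "b = u" by (simp add: b_def pu)
        thus False using jv assms(1,5) by (auto simp: b_def[symmetric] dest: symD)
      next
        case False
        have "xs = take j xs @ xs ! j # xs ! Suc j # drop (Suc (Suc j)) xs"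
          using split_nth_pair[of j xs] 1 False by (simp add: i_def)
        moreover have "xs ! j = a" "xs ! Suc j = b"
          using 1 False by (auto simp: a_def b_def p_def nth_append i_def)
        ultimately obtain qs where xs: "xs = ps @ a # b # qs" by (auto simp: ps_def)
        show False
          using hamilton_path_rotate_left[OF assms(1), of V u v x y ps a b qs ys]
            ham left right ju jv none by (simp add: xs a_def[symmetric] b_def[symmetric])
      qed
    next
      case 2
      \<comment> \<open>The position of \<open>p ! j\<close> within the tail
        \<open>v # ys\<close>.\<close>
      define m where "m = j - Suc i"
      have m: "Suc m < length (v # ys)" using j 2 by (auto simp: m_def n_def p_def i_def)
      have "p = (xs @ [u]) @ (v # ys)" by (simp add: p_def)
      hence nth: "(v # ys) ! m = p ! j" "(v # ys) ! Suc m = p ! Suc j"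
        using 2 by (auto simp: nth_append m_def i_def nth_Cons')
      define ws where "ws = take (Suc m) (v # ys)"
      define qs where "qs = drop (Suc (Suc m)) (v # ys)"
      have split: "v # ys = ws @ p ! Suc j # qs"
        using id_take_nth_drop[OF m] nth(2) by (simp add: ws_def qs_def)
      have "last ws = p ! j"
        unfolding ws_def take_Suc_conv_app_nth[OF Suc_lessD[OF m]] nth(1) by simp
      moreover have "ws \<noteq> []" "hd ws = v" by (simp_all add: ws_def)
      ultimately show False
        using hamilton_path_rotate_right[OF assms(1), of V u v x y xs ws "p ! Suc j" qs]
          ham left right ju jv none by (simp add: split)
    qed
  qed
  have "card A + card B = card (A \<union> B)"
    using disj by (subst card_Un_disjoint) (auto simp: finA finB)
  \<comment> \<open>Positions in \<open>A\<close> and \<open>B\<close> have a successor, hence lie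
    below \<open>n - 1\<close>, and \<open>i\<close> is excluded from both.\<close>
  also have "\<dots> \<le> card ({..<n - 1} - {i})"
    using iA iB by (intro card_mono) (auto simp: A_def B_def)
  also have "\<dots> = n - 2" using n2 by (subst card_Diff_singleton) auto
  finally have AB: "card A + card B \<le> n - 2" .
  have idx: "\<exists>j<n. p ! j = w" if "w \<in> V" for w
    using that set by (metis in_set_conv_nth n_def)
  \<comment> \<open>\<open>A\<close> can miss only a neighbour of \<open>u\<close> at the last
    position, and \<open>B\<close> only a neighbour of \<open>v\<close> at the first; these two make
    up for the \<open>n - 2\<close>.\<close>
  have "E `` {u} \<subseteq> insert (p ! (n - 1)) ((!) p ` A)"
  proof
    fix w assume w: "w \<in> E `` {u}"
    then obtain j where "j < n" "p ! j = w" using idx assms(2) by blast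
    moreover have "j = n - 1 \<or> Suc j < n" using \<open>j < n\<close> by linarith
    ultimately show "w \<in> insert (p ! (n - 1)) ((!) p ` A)" using w by (auto simp: A_def)
  qed
  hence "card (E `` {u}) \<le> card (insert (p ! (n - 1)) ((!) p ` A))"
    using finA by (intro card_mono) auto
  also have "\<dots> \<le> Suc (card A)"
    by (rule order.trans[OF card_insert_le_m1]) (use finA card_image_le in auto)
  finally have 1: "card (E `` {u}) \<le> Suc (card A)" .
  have "E `` {v} \<subseteq> insert (p ! 0) ((\<lambda>j. p ! Suc j) ` B)"
  proof
    fix w assume w: "w \<in> E `` {v}"
    then obtain j where "j < n" "p ! j = w" using idx assms(2) by blast
    thus "w \<in> insert (p ! 0) ((\<lambda>j. p ! Suc j) ` B)" using w by (cases j) (auto simp: B_def)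
  qed
  hence "card (E `` {v}) \<le> card (insert (p ! 0) ((\<lambda>j. p ! Suc j) ` B))"
    using finB by (intro card_mono) auto
  also have "\<dots> \<le> Suc (card B)"
    by (rule order.trans[OF card_insert_le_m1]) (use finB card_image_le in auto)
  finally have 2: "card (E `` {v}) \<le> Suc (card B)" .
  show ?thesis using 1 2 AB card n2 by linarith
qed

lemma not_successivelyE:
  assumes "\<not> successively P p"
  obtains xs a b ys where "p = xs @ a # b # ys" "\<not> P a b"
  using assms
proof (induction p arbitrary: thesis rule: induct_list012)
  case (3 x y zs)
  show ?case
  proof (cases "P x y")
    case True
    hence "\<not> successively P (y # zs)" using 3(4) by simp
    then obtain xs a b ys where "y # zs = xs @ a # b # ys" "\<not> P a b" using 3(2) by blast
    thus ?thesis using 3(3)[of "x # xs" a b ys] by simp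
  next
    case False
    thus ?thesis using 3(3)[of "[]" x y zs] by simp
  qed
qed auto

text \<open>The path must traverse the new edge, since \<open>E\<close> alone has no such path. By
  distinctness it does so only once, hence the pieces before and after lie in \<open>E\<close>. The
  two directions of traversal are symmetric.\<close>

lemma hamilton_path_edge_degree_sum:
  assumes "sym E" "irrefl E" "E \<subseteq> V \<times> V" "(u, v) \<notin> E"
    and ham: "hamilton_path V (insert (u, v) (insert (v, u) E)) x y p"
    and none: "\<nexists>p. hamilton_path V E x y p"
  shows "card (E `` {u}) + card (E `` {v}) \<le> card V"
proof -
  let ?E = "insert (u, v) (insert (v, u) E)"
  have "\<not> successively (\<lambda>a b. (a, b) \<in> E) p"
    using ham none by (auto simp: hamilton_path_def)
  then obtain xs a b ys where p: "p = xs @ a # b # ys" and ab: "(a, b) \<notin> E"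
    by (rule not_successivelyE)
  have suc: "successively (\<lambda>a b. (a, b) \<in> ?E) ((xs @ [a]) @ (b # ys))" and dist: "distinct p"
    using ham by (simp_all add: hamilton_path_def p)
  have "(a, b) \<in> ?E" using suc unfolding successively_append_iff by simp
  with ab have uv: "a = u \<and> b = v \<or> a = v \<and> b = u" by auto
  have "successively (\<lambda>a b. (a, b) \<in> ?E) (xs @ [a])"
    using suc unfolding successively_append_iff by blast
  hence left: "successively (\<lambda>a b. (a, b) \<in> E) (xs @ [a])"
    by (rule successively_mono) (use uv dist p in auto)
  have "successively (\<lambda>a b. (a, b) \<in> ?E) (b # ys)"
    using suc unfolding successively_append_iff by blast
  hence right: "successively (\<lambda>a b. (a, b) \<in> E) (b # ys)"
    by (rule successively_mono) (use uv dist p in auto)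
  have irr: "(w, w) \<notin> E" for w using assms(2) by (auto simp: irrefl_def)
  have swap: "insert (v, u) (insert (u, v) E) = ?E" by auto
  have vu: "(v, u) \<notin> E" using assms(1,4) by (auto dest: symD)
  from uv show ?thesis
  proof
    assume *: "a = u \<and> b = v"
    show ?thesis
      using crossing_degree_sum[OF assms(1,3) irr irr assms(4) _ _ _ none, of xs ys]
        ham left right p * by simp
  next
    assume *: "a = v \<and> b = u"
    show ?thesis
      using crossing_degree_sum[OF assms(1,3) irr irr vu _ _ _ none, of xs ys]
        ham left right p * swap by simp
  qed
qed

section \<open>Degree sequences of graphs without a Hamilton path\<close>

lemma complete_hamilton_path:
  assumes "finite V" "x \<in> V" "y \<in> V" "x \<noteq> y"
    and "\<And>a b. a \<in> V \<Longrightarrow> b \<in> V \<Longrightarrow> a \<noteq> b \<Longrightarrow> (a, b) \<in> E"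
  shows "\<exists>p. hamilton_path V E x y p"
proof -
  obtain zs where zs: "set zs = V - {x, y}" "distinct zs"
    using finite_distinct_list[of "V - {x, y}"] assms(1) by auto
  let ?p = "x # zs @ [y]"
  have dist: "distinct ?p" and set: "set ?p = V" using zs assms(2-4) by auto
  have "successively (\<lambda>a b. (a, b) \<in> E) ?p"
  proof (rule ccontr)
    assume "\<not> ?thesis"
    then obtain xs a b ys where "?p = xs @ a # b # ys" "(a, b) \<notin> E" by (rule not_successivelyE)
    moreover from this(1) have "a \<in> set ?p" "b \<in> set ?p" "a \<noteq> b"
      using dist by (metis in_set_conv_decomp append_Cons append_Nil append_assoc,
        metis in_set_conv_decomp append_Cons append_Nil append_assoc, metis distinct_append
        distinct_length_2_or_more)
    ultimately show False using assms(5) set by metis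
  qed
  thus ?thesis using dist set by (intro exI[of _ ?p]) (simp add: hamilton_path_def)
qed

text \<open>Induction on the number of missing arcs. Once no edge can be added by the degree sum
  criterion, \<open>h\<close> is the smaller degree in a non-adjacent pair \<open>u\<close>,
  \<open>v\<close> of maximal degree sum, and counting non-neighbours of \<open>v\<close> and of
  \<open>u\<close> gives the two bounds. The vertex \<open>u\<close> is exported because it turns a
  lower bound on all degrees into a lower bound on \<open>h\<close>.\<close>

lemma no_hamilton_path_degrees:
  assumes "finite V" "x \<in> V" "y \<in> V" "x \<noteq> y"
    and "sym E" "irrefl E" "E \<subseteq> V \<times> V" "\<nexists>p. hamilton_path V E x y p"
  obtains h u where "2 * h \<le> card V" "u \<in> V" "card (E `` {u}) \<le> h"
    "h \<le> Suc (card {w \<in> V. card (E `` {w}) \<le> h})"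
    "card V - h \<le> card {w \<in> V. card (E `` {w}) \<le> card V - h}"
  using assms(5-8)
proof (induction "card (V \<times> V - E)" arbitrary: E thesis rule: less_induct)
  case less
  let ?d = "\<lambda>w. card (E `` {w})"
  let ?n = "card V"
  have finE: "finite (E `` {w})" for w
    using finite_subset[OF less.prems(4)] assms(1) by (auto intro: finite_Image)
  define P where "P = {(a, b). a \<in> V \<and> b \<in> V \<and> a \<noteq> b \<and> (a, b) \<notin> E}"
  have finP: "finite P"
    by (rule finite_subset[of _ "V \<times> V"]) (use assms(1) in \<open>auto simp: P_def\<close>)
  have "P \<noteq> {}"
    using complete_hamilton_path[OF assms(1-4), of E] less.prems(5) by (auto simp: P_def)
  show thesis
  proof (cases "\<exists>(a, b) \<in> P. ?n < ?d a + ?d b")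
    case True
    then obtain a b where ab: "a \<in> V" "b \<in> V" "a \<noteq> b" "(a, b) \<notin> E" "?n < ?d a + ?d b"
      by (auto simp: P_def)
    let ?E = "insert (a, b) (insert (b, a) E)"
    have "\<nexists>p. hamilton_path V ?E x y p"
      using hamilton_path_edge_degree_sum[OF less.prems(2-4) ab(4) _ less.prems(5)] ab(5)
      by fastforce
    moreover have "card (V \<times> V - ?E) < card (V \<times> V - E)"
      using ab assms(1) by (intro psubset_card_mono) auto
    moreover have "sym ?E" "irrefl ?E" "?E \<subseteq> V \<times> V"
      using less.prems(2-4) ab by (auto simp: sym_def irrefl_def)
    ultimately obtain h u where h: "2 * h \<le> ?n" "u \<in> V" "card (?E `` {u}) \<le> h"
      "h \<le> Suc (card {w \<in> V. card (?E `` {w}) \<le> h})"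
      "?n - h \<le> card {w \<in> V. card (?E `` {w}) \<le> ?n - h}"
      using less.hyps[of ?E] by blast
    have fin': "finite (?E `` {w})" for w
      using finite_subset[OF \<open>?E \<subseteq> V \<times> V\<close>] assms(1) by (auto intro: finite_Image)
    \<comment> \<open>Adding the edge only raises degrees, so upper bounds on degrees in the larger
      graph are inherited.\<close>
    have mono: "?d w \<le> card (?E `` {w})" for w
      using fin' by (intro card_mono) auto
    have sub: "card {w \<in> V. card (?E `` {w}) \<le> m} \<le> card {w \<in> V. ?d w \<le> m}" for m
      using assms(1) mono by (intro card_mono) (auto intro: order_trans)
    show thesis
      using less.prems(1)[of h u] h sub[of h] sub[of "?n - h"] mono[of u] by linarith
  next
    case False
    define f where "f = (\<lambda>(a, b). ?d a + ?d b)"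
    have "Max (f ` P) \<in> f ` P" using finP \<open>P \<noteq> {}\<close> by (intro Max_in) auto
    then obtain q where q: "q \<in> P" "f q = Max (f ` P)" by auto
    have maxP: "f r \<le> f q" if "r \<in> P" for r using finP that q(2) by simp
    obtain a b where abq: "q = (a, b)" by force
    have Psym: "(d, c) \<in> P" if "(c, d) \<in> P" for c d
      using that less.prems(2) by (auto simp: P_def dest: symD)
    obtain u v where uv: "(u, v) \<in> P" "?d u \<le> ?d v" and max: "\<And>r. r \<in> P \<Longrightarrow> f r \<le> ?d u + ?d v"
    proof (cases "?d a \<le> ?d b")
      case True
      show ?thesis by (rule that[of a b]) (use True q(1) abq maxP in \<open>auto simp: f_def\<close>)
    next
      case False
      show ?thesis by (rule that[of b a]) (use False q(1) abq maxP Psym in \<open>auto simp: f_def add.commute\<close>)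
    qed
    have uvV: "u \<in> V" "v \<in> V" "u \<noteq> v" "(u, v) \<notin> E" using uv(1) by (auto simp: P_def)
    have sum: "?d u + ?d v \<le> ?n" using False uv(1) by force
    have nonadj: "card {w \<in> V. w \<noteq> z \<and> (w, z) \<notin> E} = ?n - 1 - ?d z" if "z \<in> V" for z
    proof -
      have "{w \<in> V. w \<noteq> z \<and> (w, z) \<notin> E} = (V - {z}) - E `` {z}"
        using less.prems(2) by (auto dest: symD)
      moreover have "E `` {z} \<subseteq> V - {z}" using less.prems(3,4) by (auto simp: irrefl_def)
      ultimately show ?thesis using that assms(1) finE
        by (simp add: card_Diff_subset)
    qed
    \<comment> \<open>Each non-neighbour \<open>w\<close> of \<open>v\<close> has
      \<open>?d w + ?d v\<close> at most the maximal sum \<open>?d u + ?d v\<close>, hence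
      \<open>?d w \<le> ?d u\<close>.\<close>
    have "?n - 1 - ?d v \<le> card {w \<in> V. ?d w \<le> ?d u}"
      unfolding nonadj[OF uvV(2), symmetric]
    proof (intro card_mono subsetI)
      fix w assume w: "w \<in> {w \<in> V. w \<noteq> v \<and> (w, v) \<notin> E}"
      hence "f (w, v) \<le> ?d u + ?d v" using uvV by (intro max) (auto simp: P_def)
      thus "w \<in> {w \<in> V. ?d w \<le> ?d u}" using w by (auto simp: f_def)
    qed (use assms(1) in auto)
    \<comment> \<open>The same count at \<open>u\<close> bounds degrees by \<open>?d v\<close>,
      which is at most \<open>?n - ?d u\<close>. Including \<open>u\<close> itself gains the one
      vertex needed.\<close>
    moreover have "?n - ?d u \<le> card {w \<in> V. ?d w \<le> ?n - ?d u}"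
    proof -
      let ?X = "{w \<in> V. w \<noteq> u \<and> (w, u) \<notin> E}"
      have "?d u < ?n"
        using uvV sum less.prems(4) by (intro psubset_card_mono) (use assms(1) in auto)
      hence "?n - ?d u = card (insert u ?X)"
        using nonadj[OF uvV(1)] assms(1) by simp
      also have "\<dots> \<le> card {w \<in> V. ?d w \<le> ?n - ?d u}"
      proof (intro card_mono subsetI)
        fix w assume w: "w \<in> insert u ?X"
        show "w \<in> {w \<in> V. ?d w \<le> ?n - ?d u}"
        proof (cases "w = u")
          case True
          thus ?thesis using uv(2) sum uvV by simp
        next
          case False
          hence "f (w, u) \<le> ?d u + ?d v" using w uvV by (intro max) (auto simp: P_def)
          thus ?thesis using w sum False by (auto simp: f_def)
        qed
      qed (use assms(1) in auto)
      finally show ?thesis .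
    qed
    ultimately show thesis
      using sum uv(2) uvV by (intro less.prems(1)[of "?d u" u]) auto
  qed
qed

section \<open>Eigenfunctions of threshold graphs\<close>

text \<open>For disjoint parts this is the join of a clique on \<open>W\<close> with the disjoint
  union of an edgeless graph on \<open>S\<close> and a clique on \<open>T\<close>. Arbitrary parts
  are allowed so that the pattern of \<open>R_graph\<close> can be laid over the vertices of any
  other graph.\<close>

definition threshold_arcs :: "'a set \<Rightarrow> 'a set \<Rightarrow> 'a set \<Rightarrow> 'a rel" where
  "threshold_arcs S T W = {(u, v). u \<in> S \<union> T \<union> W \<and> v \<in> S \<union> T \<union> W \<and> u \<noteq> v
     \<and> (u \<in> W \<or> v \<in> W \<or> u \<in> T \<and> v \<in> T)}"

lemma threshold_arcs_subset: "threshold_arcs S T W \<subseteq> (S \<union> T \<union> W) \<times> (S \<union> T \<union> W)"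
  by (auto simp: threshold_arcs_def)

lemma sym_threshold_arcs: "sym (threshold_arcs S T W)"
  by (auto simp: threshold_arcs_def sym_def)

lemma irrefl_threshold_arcs: "irrefl (threshold_arcs S T W)"
  by (auto simp: threshold_arcs_def irrefl_def)

text \<open>The equations are the eigenvalue equations at a vertex of \<open>S\<close>,
  \<open>T\<close> and \<open>W\<close>, with \<open>N\<close> vertices and \<open>\<sigma>\<close>
  of them in \<open>S\<close>, for the function equal to \<open>a\<close>, \<open>b\<close> and
  \<open>1\<close> on these parts. The first two express \<open>a\<close> and \<open>b\<close>
  through \<rho>; the third is then solved for \<rho> by the intermediate value theorem.\<close>

lemma threshold_positive_solution:
  fixes N \<sigma> t :: real
  assumes "1 \<le> \<sigma>" "2 * \<sigma> + 2 \<le> N" "0 \<le> t"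
  obtains \<rho> a b where "0 < a" "a \<le> b" "2 * \<sigma> + 2 < N \<longrightarrow> a < b" "b < 1"
    "t * (\<sigma> + 1) * a + (\<sigma> + 1) = \<rho> * a"
    "t * (N - \<sigma> - 1) * b + (\<sigma> + 1) + (N - 2 * \<sigma> - 2) * b = \<rho> * b"
    "t * (N - 1) + \<sigma> + \<sigma> * a + (N - 2 * \<sigma> - 1) * b = \<rho>"
proof -
  \<comment> \<open>At \<open>L\<close> the second equation gives \<open>b = 1\<close>, and
    \<open>p\<close> and \<open>q\<close> are positive from there on; \<open>U\<close> is
    \<open>t + 1\<close> times the largest degree \<open>N - 1\<close>.\<close>
  define L where "L = (t + 1) * (N - \<sigma> - 1)"
  define U where "U = (t + 1) * (N - 1)"
  \<comment> \<open>The first two equations read \<open>a * p \<rho> = \<sigma> + 1\<close> and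
    \<open>b * q \<rho> = \<sigma> + 1\<close>; the zeros of \<open>g\<close> solve the third after
    substitution.\<close>
  define p where "p = (\<lambda>r. r - t * (\<sigma> + 1))"
  define q where "q = (\<lambda>r. r - t * (N - \<sigma> - 1) - (N - 2 * \<sigma> - 2))"
  define g where "g = (\<lambda>r. r - t * (N - 1) - \<sigma> - \<sigma> * ((\<sigma> + 1) / p r)
    - (N - 2 * \<sigma> - 1) * ((\<sigma> + 1) / q r))"
  have tN: "0 \<le> t * (N - 2 * \<sigma> - 2)" and t\<sigma>: "0 \<le> t * \<sigma>" using assms by simp_all
  have pq: "p r = q r + (t * (N - 2 * \<sigma> - 2) + (N - 2 * \<sigma> - 2))" for r
    by (simp add: p_def q_def algebra_simps)
  have q: "\<sigma> + 1 \<le> q r" if "L \<le> r" for r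
    using that by (simp add: q_def L_def algebra_simps)
  have pos: "0 < q r" "q r \<le> p r" "0 < p r" if "L \<le> r" for r
    using q[OF that] pq[of r] tN assms by linarith+
  have "L \<le> U" using assms by (simp add: L_def U_def mult_left_mono)
  have "continuous_on {L..U} g"
    unfolding g_def p_def q_def
    by (intro continuous_intros) (use pos in \<open>auto simp: p_def q_def less_imp_neq[symmetric]\<close>)
  moreover have "g L \<le> 0"
  proof -
    have "q L = \<sigma> + 1" by (simp add: q_def L_def algebra_simps)
    hence "(\<sigma> + 1) / q L = 1" using assms by simp
    hence "g L = - (t * \<sigma>) - \<sigma> * ((\<sigma> + 1) / p L)"
      unfolding g_def by (simp only:) (simp add: L_def algebra_simps)
    moreover have "0 \<le> \<sigma> * ((\<sigma> + 1) / p L)" using pos(3)[of L] assms by simp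
    ultimately show ?thesis using t\<sigma> by linarith
  qed
  moreover have "0 \<le> g U"
  proof -
    have "(\<sigma> + 1) / q U \<le> 1" using q[OF \<open>L \<le> U\<close>] pos[OF \<open>L \<le> U\<close>] by simp
    hence "(N - 2 * \<sigma> - 1) * ((\<sigma> + 1) / q U) \<le> N - 2 * \<sigma> - 1"
      using assms by (intro mult_left_le) auto
    moreover have "(\<sigma> + 1) / p U \<le> 1" using q[OF \<open>L \<le> U\<close>] pos[OF \<open>L \<le> U\<close>] by simp
    hence "\<sigma> * ((\<sigma> + 1) / p U) \<le> \<sigma>" using assms by (intro mult_left_le) auto
    moreover have "U - t * (N - 1) = N - 1" by (simp add: U_def algebra_simps)
    ultimately show ?thesis unfolding g_def by linarith
  qed
  ultimately obtain \<rho> where \<rho>: "L \<le> \<rho>" "g \<rho> = 0"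
    using IVT'[of g L 0 U] \<open>L \<le> U\<close> by blast
  define a where "a = (\<sigma> + 1) / p \<rho>"
  define b where "b = (\<sigma> + 1) / q \<rho>"
  note pos = pos[OF \<rho>(1)]
  have a: "a * p \<rho> = \<sigma> + 1" and b: "b * q \<rho> = \<sigma> + 1"
    using pos by (simp_all add: a_def b_def)
  have a0: "0 < a" using pos assms by (simp add: a_def)
  have ab: "a \<le> b" unfolding a_def b_def using pos assms by (intro divide_left_mono) auto
  have ab': "2 * \<sigma> + 2 < N \<longrightarrow> a < b"
  proof
    assume that: "2 * \<sigma> + 2 < N"
    have "q \<rho> < p \<rho>" using that tN pq[of \<rho>] by linarith
    thus "a < b" unfolding a_def b_def using pos assms by (intro divide_strict_left_mono) auto
  qed
  have eq: "t * (N - 1) + \<sigma> + \<sigma> * a + (N - 2 * \<sigma> - 1) * b = \<rho>"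
    using \<rho>(2) by (simp add: g_def a_def b_def)
  have eb: "t * (N - \<sigma> - 1) * b + (\<sigma> + 1) + (N - 2 * \<sigma> - 2) * b = \<rho> * b"
    using b by (simp add: q_def algebra_simps)
  \<comment> \<open>The difference of the third and the second equation, with \<open>1 - b\<close>
    factored out.\<close>
  have "(q \<rho> + (N - 2 * \<sigma> - 1)) * (1 - b) = t * \<sigma> + \<sigma> * a"
    using eq eb by (simp add: q_def algebra_simps)
  moreover have "0 < t * \<sigma> + \<sigma> * a" using t\<sigma> a0 assms by (simp add: add_nonneg_pos)
  ultimately have "0 < (q \<rho> + (N - 2 * \<sigma> - 1)) * (1 - b)" by simp
  hence "b < 1" using pos assms by (simp add: zero_less_mult_iff)
  show thesis
    by (rule that[OF a0 ab ab' \<open>b < 1\<close> _ eb eq]) (use a in \<open>auto simp: p_def algebra_simps\<close>)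
qed

text \<open>Cancel the common part: \<open>A - B\<close> has at most as many elements as the
  nonempty set \<open>B - A\<close>, and each weighs less than the minimum over
  \<open>B - A\<close>. Positivity of the weights covers the case where \<open>A - B\<close> is
  smaller or empty.\<close>

lemma sum_less_if_dominated:
  fixes g :: "'a \<Rightarrow> real"
  assumes "finite A" "finite B" "card A \<le> card B"
    and "\<And>w. w \<in> B \<Longrightarrow> 0 < g w"
    and "\<And>v w. v \<in> A - B \<Longrightarrow> w \<in> B - A \<Longrightarrow> g v < g w"
    and "A \<noteq> B"
  shows "sum g A < sum g B"
proof -
  let ?D = "A - B" and ?D' = "B - A"
  have split: "sum g A = sum g (A \<inter> B) + sum g ?D" "sum g B = sum g (A \<inter> B) + sum g ?D'"
    using sum.Int_Diff[of A g B] sum.Int_Diff[of B g A] assms by (simp_all add: Int_commute)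
  have card: "card ?D \<le> card ?D'"
    using assms(1-3) card_Diff_subset_Int[of A B] card_Diff_subset_Int[of B A]
    by (simp add: Int_commute)
  have ne: "?D' \<noteq> {}"
  proof
    assume "?D' = {}"
    moreover from this have "?D = {}" using card assms(1) by (metis card.empty card_eq_0_iff
      finite_Diff le_zero_eq)
    ultimately show False using assms(6) by blast
  qed
  define m where "m = Min (g ` ?D')"
  have m: "m \<in> g ` ?D'" unfolding m_def using ne assms(2) by (intro Min_in) auto
  hence m0: "0 < m" using assms(4) by auto
  have D': "of_nat (card ?D') * m \<le> sum g ?D'"
    by (rule sum_bounded_below) (use assms(2) in \<open>simp add: m_def\<close>)
  have "sum g ?D < sum g ?D'"
  proof (cases "?D = {}")
    case True
    have "0 < sum g ?D'" using ne assms(2,4) by (intro sum_pos) auto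
    thus ?thesis by (simp only: True sum.empty)
  next
    case False
    have "sum g ?D < of_nat (card ?D) * m"
      using False assms(1,5) m by (intro sum_bounded_above_strict) (auto simp: card_gt_0_iff)
    also have "\<dots> \<le> of_nat (card ?D') * m" using card m0 by simp
    finally show ?thesis using D' by simp
  qed
  thus ?thesis using split by simp
qed

lemma threshold_arcs_Image:
  assumes "S \<inter> T = {}" "S \<inter> W = {}" "T \<inter> W = {}"
  shows "v \<in> S \<Longrightarrow> threshold_arcs S T W `` {v} = W"
    and "v \<in> T \<Longrightarrow> threshold_arcs S T W `` {v} = (T - {v}) \<union> W"
    and "v \<in> W \<Longrightarrow> threshold_arcs S T W `` {v} = (S \<union> T \<union> W) - {v}"
  using assms by (auto simp: threshold_arcs_def)

text \<open>In the threshold graph a vertex is joined to the vertices of largest weight other than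
  itself. Any different neighbourhood that is no larger therefore has a smaller sum. The degree
  bounds supply "no larger" on \<open>S\<close> and \<open>T\<close>; on \<open>W\<close> it is
  automatic.\<close>

lemma threshold_supersolution:
  fixes S T W :: "'a set" and n s :: nat and t :: real
  assumes "finite S" "finite T" "finite W"
    and disj: "S \<inter> T = {}" "S \<inter> W = {}" "T \<inter> W = {}"
    and card: "card S = s" "card T = n - 2 * s - 1" "card W = s + 1"
    and "1 \<le> s" "2 * s + 2 \<le> n" "0 \<le> t"
  fixes \<rho> a b :: real
  assumes ab: "0 < a" "a \<le> b" "2 * real s + 2 < real n \<longrightarrow> a < b" "b < 1"
    and eqs: "t * (real s + 1) * a + (real s + 1) = \<rho> * a"
    "t * (real n - real s - 1) * b + (real s + 1) + (real n - 2 * real s - 2) * b = \<rho> * b"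
    "t * (real n - 1) + real s + real s * a + (real n - 2 * real s - 1) * b = \<rho>"
  defines "f \<equiv> \<lambda>v. if v \<in> S then a else if v \<in> T then b else 1"
  defines "X \<equiv> threshold_arcs S T W" and "V \<equiv> S \<union> T \<union> W"
  shows "v \<in> V \<Longrightarrow> (\<Sum>w\<in>X `` {v}. t * f v + f w) = \<rho> * f v"
    and "\<lbrakk>E \<subseteq> V \<times> V; irrefl E; \<And>v. v \<in> S \<Longrightarrow> card (E `` {v}) \<le> s + 1;
      \<And>v. v \<in> T \<Longrightarrow> card (E `` {v}) \<le> n - s - 1; v \<in> V; E `` {v} \<noteq> X `` {v}\<rbrakk>
      \<Longrightarrow> (\<Sum>w\<in>E `` {v}. t * f v + f w) < \<rho> * f v"
proof -
  note fin = assms(1-3)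
  note Im = threshold_arcs_Image[OF disj]
  have f: "w \<in> S \<Longrightarrow> f w = a" "w \<in> T \<Longrightarrow> f w = b" "w \<in> W \<Longrightarrow> f w = 1" for w
    using disj by (auto simp: f_def)
  have sums: "sum f S = real s * a" "sum f T = (real n - 2 * real s - 1) * b" "sum f W = real s + 1"
    using card assms(11) by (simp_all add: f of_nat_diff cong: sum.cong)
  have cardV: "card V = n"
    using fin disj card assms(11) by (simp add: V_def card_Un_disjoint Int_Un_distrib2)
  have finV: "finite V" using fin by (simp add: V_def)
  have sumV: "sum f V = real s * a + (real n - 2 * real s - 1) * b + (real s + 1)"
    unfolding V_def using fin disj sums by (simp add: sum.union_disjoint Int_Un_distrib2)
  have finX: "finite (X `` {v})" for v
    by (rule finite_subset[OF _ finV]) (auto simp: X_def V_def threshold_arcs_def)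
  show eq: "(\<Sum>w\<in>X `` {v}. t * f v + f w) = \<rho> * f v" if "v \<in> V" for v
  proof -
    have *: "(\<Sum>w\<in>X `` {v}. t * f v + f w) = t * f v * real (card (X `` {v})) + sum f (X `` {v})"
      by (simp add: sum.distrib)
    consider "v \<in> S" | "v \<in> T" | "v \<in> W" using \<open>v \<in> V\<close> by (auto simp: V_def)
    thus ?thesis
    proof cases
      case 1
      have "card (X `` {v}) = s + 1" "sum f (X `` {v}) = real s + 1"
        using card sums by (simp_all add: X_def Im 1)
      thus ?thesis using eqs(1) by (simp add: * f 1 algebra_simps)
    next
      case 2
      have "card (X `` {v}) = n - s - 1"
        using fin disj card assms(11) 2
        by (simp add: X_def Im 2, subst card_Un_disjoint) auto
      moreover have "sum f (X `` {v}) = real s + 1 + (real n - 2 * real s - 2) * b"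
      proof -
        have "X `` {v} = (T - {v}) \<union> W" by (simp add: X_def Im 2)
        moreover have "sum f ((T - {v}) \<union> W) = sum f (T - {v}) + sum f W"
          using fin disj by (intro sum.union_disjoint) auto
        moreover have "sum f (T - {v}) = sum f T - f v" using fin 2 by (simp add: sum_diff1)
        ultimately show ?thesis using sums f(2)[OF 2] by (simp add: algebra_simps)
      qed
      ultimately show ?thesis using eqs(2) assms(11)
        by (simp add: * f 2 of_nat_diff algebra_simps)
    next
      case 3
      have X: "X `` {v} = V - {v}" by (simp add: X_def Im(3)[OF 3] V_def)
      have "card (X `` {v}) = n - 1"
        using cardV finV \<open>v \<in> V\<close> by (simp add: X)
      moreover have "sum f (X `` {v}) = real s * a + (real n - 2 * real s - 1) * b + real s"
        using sumV finV \<open>v \<in> V\<close> by (simp add: X sum_diff1 f 3)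
      ultimately show ?thesis using eqs(3) assms(11)
        by (simp add: * f 3 of_nat_diff algebra_simps)
    qed
  qed
  assume E: "E \<subseteq> V \<times> V" "irrefl E" "\<And>v. v \<in> S \<Longrightarrow> card (E `` {v}) \<le> s + 1"
    "\<And>v. v \<in> T \<Longrightarrow> card (E `` {v}) \<le> n - s - 1" "v \<in> V" "E `` {v} \<noteq> X `` {v}"
  have finE: "finite (E `` {v})"
    by (rule finite_subset[OF _ finV]) (use E(1) in auto)
  have sub: "E `` {v} \<subseteq> V - {v}" using E(1,2) by (auto simp: irrefl_def)
  have "(\<Sum>w\<in>E `` {v}. t * f v + f w) < (\<Sum>w\<in>X `` {v}. t * f v + f w)"
  proof (rule sum_less_if_dominated[OF finE finX _ _ _ E(6)])
    show "0 < t * f v + f w" for w using ab(1,2,4) assms(12) by (auto simp: f_def add_nonneg_pos)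
    consider "v \<in> S" | "v \<in> T" | "v \<in> W" using E(5) by (auto simp: V_def)
    note cases = this
    from cases show "card (E `` {v}) \<le> card (X `` {v})"
    proof cases
      case 1
      thus ?thesis using E(3)[OF 1] card by (simp add: X_def Im 1)
    next
      case 2
      have "card (X `` {v}) = n - s - 1"
        using fin disj card assms(11) 2
        by (simp add: X_def Im 2, subst card_Un_disjoint) auto
      thus ?thesis using E(4)[OF 2] by simp
    next
      case 3
      show ?thesis unfolding X_def Im(3)[OF 3] using sub finV
        by (intro card_mono) (auto simp: V_def)
    qed
    fix u w assume u: "u \<in> E `` {v} - X `` {v}" and w: "w \<in> X `` {v} - E `` {v}"
    from cases have "f u < f w"
    proof cases
      case 1
      hence "w \<in> W" "u \<in> S \<union> T" using u w sub by (auto simp: X_def Im V_def)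
      thus ?thesis using ab f by auto
    next
      case 2
      hence uw: "w \<in> T - {v} \<or> w \<in> W" "u \<in> S" using u w sub by (auto simp: X_def Im V_def)
      show ?thesis
      proof (cases "w \<in> W")
        case True
        thus ?thesis using ab f uw by auto
      next
        \<comment> \<open>Only here is \<open>a < b\<close> needed. The two vertices
          \<open>v\<close> and \<open>w\<close> show that \<open>T\<close> is not a singleton, that
          is, \<open>n > 2 * s + 2\<close>; for a singleton \<open>T\<close> the values
          \<open>a\<close> and \<open>b\<close> coincide.\<close>
        case False
        hence "card {v, w} \<le> card T" "v \<noteq> w"
          using uw 2 fin by (auto intro: card_mono)
        hence "2 * real s + 2 < real n" using card by (auto simp: card_insert_if)
        thus ?thesis using ab(3) f uw False by auto
      qed
    next
      \<comment> \<open>The vertex \<open>v\<close> is joined to all others in the threshold graph,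
        so no such \<open>u\<close> exists.\<close>
      case 3
      thus ?thesis using u sub by (auto simp: X_def Im V_def)
    qed
    thus "t * f v + f u < t * f v + f w" by simp
  qed
  thus "(\<Sum>w\<in>E `` {v}. t * f v + f w) < \<rho> * f v" using eq[OF E(5)] by simp
qed

text \<open>For \<open>y = \<bar>x\<bar>\<close> the operator \<open>Q\<close> satisfies
  \<open>\<mu> * y \<le> Q y\<close>, while \<open>Q f \<le> \<rho> * f\<close>. As \<open>Q\<close>
  is self-adjoint, pairing \<open>f\<close> with \<open>y\<close> compares \<mu> with \<rho>. The
  two further claims are the equality case; the last one says that the support of \<open>x\<close>
  is closed under adjacency.\<close>

lemma eigenfunction_bound:
  fixes f x :: "'a \<Rightarrow> real" and t \<mu> \<rho> :: real
  assumes "finite V" "sym E" "E \<subseteq> V \<times> V" "0 \<le> t"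
    and f: "\<And>v. v \<in> V \<Longrightarrow> 0 < f v"
    and super: "\<And>v. v \<in> V \<Longrightarrow> (\<Sum>w\<in>E `` {v}. t * f v + f w) \<le> \<rho> * f v"
    and eig: "\<And>v. v \<in> V \<Longrightarrow> (\<Sum>w\<in>E `` {v}. t * x v + x w) = \<mu> * x v"
    and nz: "z \<in> V" "x z \<noteq> 0"
  shows "\<mu> \<le> \<rho>"
    and "\<lbrakk>\<mu> = \<rho>; v \<in> V; x v \<noteq> 0\<rbrakk> \<Longrightarrow> (\<Sum>w\<in>E `` {v}. t * f v + f w) = \<rho> * f v"
    and "\<lbrakk>\<mu> = \<rho>; (v, w) \<in> E; x v \<noteq> 0\<rbrakk> \<Longrightarrow> x w \<noteq> 0"
proof -
  define y where "y = (\<lambda>v. \<bar>x v\<bar>)"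
  define Q where "Q = (\<lambda>g v. \<Sum>w\<in>E `` {v}. t * g v + g w :: real)"
  have finE: "finite (E `` {v})" for v
    by (rule finite_subset[OF _ assms(1)]) (use assms(3) in auto)
  have y: "\<mu> * y v \<le> Q y v" if "v \<in> V" for v
  proof -
    have "\<mu> * y v \<le> \<bar>\<mu> * x v\<bar>"
      unfolding y_def abs_mult by (intro mult_right_mono) auto
    also have "\<dots> \<le> (\<Sum>w\<in>E `` {v}. \<bar>t * x v + x w\<bar>)"
      unfolding eig[OF that, symmetric] by (rule sum_abs)
    also have "\<dots> \<le> Q y v"
      unfolding Q_def y_def using assms(4)
      by (intro sum_mono order_trans[OF abs_triangle_ineq]) (simp add: abs_mult)
    finally show ?thesis .
  qed
  have self_adjoint: "(\<Sum>v\<in>V. f v * Q y v) = (\<Sum>v\<in>V. y v * Q f v)"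
  proof -
    have expand: "(\<Sum>v\<in>V. g v * Q h v) = (\<Sum>v\<in>V. t * real (card (E `` {v})) * g v * h v)
        + (\<Sum>v\<in>V. \<Sum>w\<in>V. if (v, w) \<in> E then g v * h w else 0)" for g h
    proof -
      have "(\<Sum>w\<in>V. if (v, w) \<in> E then g v * h w else 0) = g v * sum h (E `` {v})" for v
      proof -
        have "V \<inter> {w. (v, w) \<in> E} = E `` {v}" using assms(3) by auto
        thus ?thesis using assms(1) by (simp add: sum.If_cases sum_distrib_left)
      qed
      thus ?thesis
        by (simp add: Q_def sum.distrib algebra_simps)
    qed
    \<comment> \<open>The degree part is symmetric termwise; for the adjacency part, exchange the
      sums and use symmetry of \<open>E\<close>.\<close>
    have "(\<Sum>v\<in>V. \<Sum>w\<in>V. if (v, w) \<in> E then f v * y w else 0)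
        = (\<Sum>w\<in>V. \<Sum>v\<in>V. if (v, w) \<in> E then f v * y w else 0)"
      by (rule sum.swap)
    also have "\<dots> = (\<Sum>w\<in>V. \<Sum>v\<in>V. if (w, v) \<in> E then y w * f v else 0)"
      using assms(2) by (intro sum.cong refl) (auto dest: symD)
    finally show ?thesis unfolding expand by (simp add: mult_ac)
  qed
  have chain1: "\<mu> * (\<Sum>v\<in>V. f v * y v) \<le> (\<Sum>v\<in>V. f v * Q y v)"
    unfolding sum_distrib_left
  proof (rule sum_mono)
    fix v assume v: "v \<in> V"
    show "\<mu> * (f v * y v) \<le> f v * Q y v"
      using mult_left_mono[OF y[OF v] less_imp_le[OF f[OF v]]] by (simp add: mult_ac)
  qed
  have y0: "0 \<le> y v" for v by (simp add: y_def)
  have chain2': "y v * Q f v \<le> \<rho> * (f v * y v)" if "v \<in> V" for v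
    using mult_left_mono[OF super[OF that] y0[of v]] by (simp add: Q_def mult_ac)
  have chain2: "(\<Sum>v\<in>V. y v * Q f v) \<le> \<rho> * (\<Sum>v\<in>V. f v * y v)"
    unfolding sum_distrib_left using chain2' by (rule sum_mono)
  have "0 < (\<Sum>v\<in>V. f v * y v)"
    using f nz assms(1) by (intro sum_pos2[of _ z]) (auto simp: y_def less_imp_le)
  moreover have "\<mu> * (\<Sum>v\<in>V. f v * y v) \<le> \<rho> * (\<Sum>v\<in>V. f v * y v)"
    using chain1 chain2 self_adjoint by linarith
  ultimately show "\<mu> \<le> \<rho>" by simp
  \<comment> \<open>The chain is now tight, and its inequalities hold termwise. Thus
    \<open>f\<close> satisfies the eigenvalue equation wherever \<open>y\<close> is nonzero, and
    \<open>y\<close> satisfies it everywhere because \<open>f\<close> is positive.\<close>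
  assume \<mu>: "\<mu> = \<rho>"
  have eq: "(\<Sum>v\<in>V. y v * Q f v) = (\<Sum>v\<in>V. \<rho> * (f v * y v))"
    using chain1 chain2 self_adjoint by (simp add: \<mu> sum_distrib_left[symmetric])
  have eq2: "(\<Sum>v\<in>V. f v * Q y v) = (\<Sum>v\<in>V. f v * (\<rho> * y v))"
    using eq self_adjoint by (simp add: mult_ac)
  show "(\<Sum>w\<in>E `` {v}. t * f v + f w) = \<rho> * f v" if "v \<in> V" "x v \<noteq> 0"
    using sum_mono_inv[OF eq chain2' that(1) assms(1)] that(2) by (simp add: Q_def y_def mult_ac)
  have Qy: "Q y v = \<rho> * y v" if "v \<in> V" for v
  proof -
    have "f v * (\<rho> * y v) = f v * Q y v"
    proof (rule sum_mono_inv[OF eq2[symmetric] _ that assms(1)])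
      show "f v * (\<rho> * y v) \<le> f v * Q y v" if "v \<in> V" for v
        using y[OF that] f[OF that] by (simp add: \<mu>)
    qed
    thus ?thesis using f[OF that] by simp
  qed
  show "x w \<noteq> 0" if vw: "(v, w) \<in> E" and "x v \<noteq> 0"
  proof
    assume "x w = 0"
    moreover have "w \<in> V" using vw assms(3) by auto
    \<comment> \<open>At a zero of \<open>y\<close> the equation leaves a vanishing sum of
      nonnegative values over the neighbours.\<close>
    ultimately have "(\<Sum>u\<in>E `` {w}. y u) = 0" using Qy[of w] by (simp add: Q_def y_def)
    hence "y v = 0"
      using symD[OF assms(2) vw] finE y0 by (subst (asm) sum_nonneg_eq_0_iff) auto
    thus False using \<open>x v \<noteq> 0\<close> by (simp add: y_def)
  qed
qed

section \<open>Spectra of graph matrices\<close>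

text \<open>The value \<open>t = 0\<close> gives the adjacency matrix and \<open>t = 1\<close> the
  signless Laplacian, so one argument serves both radii.\<close>

definition degree_adjacency_matrix :: "real \<Rightarrow> nat pair_pre_digraph \<Rightarrow> real mat" where
  "degree_adjacency_matrix t G = t \<cdot>\<^sub>m degree_matrix G + adjacency_matrix G"

lemma adjacency_radius_eq:
  "adjacency_radius G = largest_eigenvalue (degree_adjacency_matrix 0 G)"
proof -
  have "degree_adjacency_matrix 0 G = adjacency_matrix G"
    by (rule eq_matI)
      (auto simp: degree_adjacency_matrix_def degree_matrix_def adjacency_matrix_def)
  thus ?thesis by (simp add: adjacency_radius_def)
qed

lemma signless_laplacian_radius_eq:
  "signless_laplacian_radius G = largest_eigenvalue (degree_adjacency_matrix 1 G)"
proof -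
  have "degree_adjacency_matrix 1 G = degree_matrix G + adjacency_matrix G"
    by (rule eq_matI)
      (auto simp: degree_adjacency_matrix_def degree_matrix_def adjacency_matrix_def)
  thus ?thesis by (simp add: signless_laplacian_radius_def)
qed

lemma eigenvalue_iff_eigenfunction:
  fixes A :: "'a :: field mat"
  assumes A: "A \<in> carrier_mat n n"
  shows "eigenvalue A \<mu> \<longleftrightarrow>
    (\<exists>x. (\<exists>i<n. x i \<noteq> 0) \<and> (\<forall>i<n. (\<Sum>j<n. A $$ (i, j) * x j) = \<mu> * x i))"
proof
  assume "eigenvalue A \<mu>"
  then obtain v where v: "v \<in> carrier_vec n" "v \<noteq> 0\<^sub>v n" "A *\<^sub>v v = \<mu> \<cdot>\<^sub>v v"
    using A by (auto simp: eigenvalue_def eigenvector_def)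
  have "\<exists>i<n. v $ i \<noteq> 0" using v(1,2) by (metis carrier_vecD eq_vecI index_zero_vec)
  moreover have "(\<Sum>j<n. A $$ (i, j) * v $ j) = \<mu> * v $ i" if "i < n" for i
    using arg_cong[OF v(3), of "\<lambda>w. w $ i"] that v(1) A
    by (simp add: scalar_prod_def atLeast0LessThan)
  ultimately show "\<exists>x. (\<exists>i<n. x i \<noteq> 0) \<and> (\<forall>i<n. (\<Sum>j<n. A $$ (i, j) * x j) = \<mu> * x i)"
    by (intro exI[of _ "\<lambda>i. v $ i"]) auto
next
  assume "\<exists>x. (\<exists>i<n. x i \<noteq> 0) \<and> (\<forall>i<n. (\<Sum>j<n. A $$ (i, j) * x j) = \<mu> * x i)"
  then obtain x where x: "\<exists>i<n. x i \<noteq> 0" "\<And>i. i < n \<Longrightarrow> (\<Sum>j<n. A $$ (i, j) * x j) = \<mu> * x i"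
    by blast
  have "vec n x \<noteq> 0\<^sub>v n" using x(1) by (metis index_vec index_zero_vec(1))
  moreover have "A *\<^sub>v vec n x = \<mu> \<cdot>\<^sub>v vec n x"
    using A x(2) by (intro eq_vecI) (auto simp: scalar_prod_def atLeast0LessThan)
  ultimately have "eigenvector A (vec n x) \<mu>" using A by (simp add: eigenvector_def)
  thus "eigenvalue A \<mu>" by (auto simp: eigenvalue_def)
qed

text \<open>Makes the \<open>Max\<close> in \<open>largest_eigenvalue\<close> meaningful. A complex
  eigenvalue exists, it is real because the quadratic form of a real symmetric matrix is, and it is
  then a root of the real characteristic polynomial.\<close>

lemma symmetric_real_spectrum_nonempty:
  fixes A :: "real mat"
  assumes A: "A \<in> carrier_mat n n" and "0 < n"
    and sym: "\<And>i j. i < n \<Longrightarrow> j < n \<Longrightarrow> A $$ (i, j) = A $$ (j, i)"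
  shows "spectrum A \<noteq> {}"
proof -
  define B where "B = map_mat complex_of_real A"
  have B: "B \<in> carrier_mat n n" using A by (simp add: B_def)
  obtain \<mu> where "eigenvalue B \<mu>"
    using spectrum_non_empty[OF B assms(2)] by (auto simp: spectrum_def)
  then obtain x where x: "\<exists>i<n. x i \<noteq> 0"
    and "\<And>i. i < n \<Longrightarrow> (\<Sum>j<n. B $$ (i, j) * x j) = \<mu> * x i"
    using eigenvalue_iff_eigenfunction[OF B] by blast
  hence eig: "(\<Sum>j<n. of_real (A $$ (i, j)) * x j) = \<mu> * x i" if "i < n" for i
    using that A by (simp add: B_def)
  define q where "q = (\<Sum>i<n. \<Sum>j<n. cnj (x i) * (of_real (A $$ (i, j)) * x j))"
  define r where "r = (\<Sum>i<n. (cmod (x i))\<^sup>2)"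
  have "q = (\<Sum>i<n. cnj (x i) * (\<mu> * x i))"
    using eig by (simp add: q_def sum_distrib_left[symmetric])
  also have "\<dots> = \<mu> * of_real r"
    by (simp add: r_def sum_distrib_left complex_norm_square mult_ac del: of_real_power)
  finally have q: "q = \<mu> * of_real r" .
  have "cnj q = (\<Sum>i<n. \<Sum>j<n. cnj (x j) * (of_real (A $$ (j, i)) * x i))"
    using sym by (simp add: q_def mult_ac)
  also have "\<dots> = q" unfolding q_def by (rule sum.swap)
  finally have "cnj q = q" .
  moreover have "0 < r" unfolding r_def using x by (auto intro: sum_pos2)
  ultimately have "cnj \<mu> = \<mu>" using q by auto
  then obtain m where m: "\<mu> = of_real m" by (metis Reals_cnj_iff Reals_cases)
  have "poly (char_poly B) \<mu> = 0"
    using \<open>eigenvalue B \<mu>\<close> eigenvalue_root_char_poly[OF B] by simp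
  moreover have "char_poly B = map_poly of_real (char_poly A)"
    unfolding B_def by (rule of_real_hom.char_poly_hom[OF A])
  ultimately have "poly (char_poly A) m = 0" by (simp add: m)
  thus ?thesis using eigenvalue_root_char_poly[OF A] by (auto simp: spectrum_def)
qed

section \<open>Graph matrices acting on functions on the vertices\<close>

lemma out_degree_eq_card_Image: "out_degree (with_proj G) v = card (parcs G `` {v})"
proof -
  have "out_arcs (with_proj G) v = Pair v ` (parcs G `` {v})"
    by (auto simp: out_arcs_def)
  thus ?thesis by (simp add: out_degree_def card_image inj_on_def)
qed

lemma pair_graph_iff:
  "pair_graph G \<longleftrightarrow> finite (pverts G) \<and> parcs G \<subseteq> pverts G \<times> pverts G \<and> sym (parcs G) \<and> irrefl (parcs G)"
proof
  assume "pair_graph G"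
  then interpret pair_graph G .
  show "finite (pverts G) \<and> parcs G \<subseteq> pverts G \<times> pverts G \<and> sym (parcs G) \<and> irrefl (parcs G)"
    using arc_fst_in_verts arc_snd_in_verts no_loops' pair_finite_verts pair_sym_arcs
    by (fastforce simp: irrefl_def symmetric_def)
next
  assume *: "finite (pverts G) \<and> parcs G \<subseteq> pverts G \<times> pverts G \<and> sym (parcs G) \<and> irrefl (parcs G)"
  hence "finite (parcs G)" by (meson finite_SigmaI finite_subset)
  with * show "pair_graph G"
    by unfold_locales (auto simp: irrefl_def symmetric_def)
qed

lemma graphs_of_orderD:
  assumes "G \<in> graphs_of_order n"
  shows "pverts G = {0..<n}" "parcs G \<subseteq> {0..<n} \<times> {0..<n}" "sym (parcs G)" "irrefl (parcs G)"
  using assms by (auto simp: graphs_of_order_def pair_graph_iff)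

lemma finite_graphs_of_order: "finite (graphs_of_order n)"
proof (rule finite_subset)
  show "graphs_of_order n \<subseteq> (\<lambda>E. \<lparr>pverts = {0..<n}, parcs = E\<rparr>) ` Pow ({0..<n} \<times> {0..<n})"
  proof
    fix G :: "nat pair_pre_digraph" assume "G \<in> graphs_of_order n"
    note G = graphs_of_orderD[OF this]
    have "G = \<lparr>pverts = {0..<n}, parcs = parcs G\<rparr>" using G(1) by simp
    thus "G \<in> (\<lambda>E. \<lparr>pverts = {0..<n}, parcs = E\<rparr>) ` Pow ({0..<n} \<times> {0..<n})"
      using G(2) by blast
  qed
qed auto

lemma degree_adjacency_matrix_carrier:
  assumes "G \<in> graphs_of_order n"
  shows "degree_adjacency_matrix t G \<in> carrier_mat n n"
  using graphs_of_orderD[OF assms]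
  by (simp add: degree_adjacency_matrix_def adjacency_matrix_def degree_matrix_def)

lemma degree_adjacency_matrix_index:
  assumes "G \<in> graphs_of_order n" "i < n" "j < n"
  shows "degree_adjacency_matrix t G $$ (i, j) =
    (if i = j then t * real (card (parcs G `` {i})) else 0) + (if (i, j) \<in> parcs G then 1 else 0)"
  using graphs_of_orderD[OF assms(1)] assms(2,3)
  by (simp add: degree_adjacency_matrix_def adjacency_matrix_def degree_matrix_def
      out_degree_eq_card_Image)

text \<open>The diagonal term is \<open>t * x i\<close> taken once per neighbour, so it can be
  distributed over the neighbours of \<open>i\<close>.\<close>

lemma degree_adjacency_matrix_row_sum:
  assumes G: "G \<in> graphs_of_order n" and i: "i < n"
  shows "(\<Sum>j<n. degree_adjacency_matrix t G $$ (i, j) * x j) = (\<Sum>w\<in>parcs G `` {i}. t * x i + x w)"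
proof -
  have Im: "{..<n} \<inter> {j. (i, j) \<in> parcs G} = parcs G `` {i}"
    using graphs_of_orderD(2)[OF G] by auto
  have "(\<Sum>j<n. degree_adjacency_matrix t G $$ (i, j) * x j)
      = (\<Sum>j<n. (if i = j then t * real (card (parcs G `` {i})) * x j else 0)
          + (if (i, j) \<in> parcs G then x j else 0))"
    using i by (intro sum.cong) (auto simp: degree_adjacency_matrix_index[OF G] algebra_simps)
  also have "\<dots> = t * real (card (parcs G `` {i})) * x i + sum x (parcs G `` {i})"
    using i by (simp add: sum.distrib sum.If_cases Im)
  finally show ?thesis by (simp add: sum.distrib)
qed

lemma in_spectrum_iff_eigenfunction:
  assumes G: "G \<in> graphs_of_order n"
  shows "\<mu> \<in> spectrum (degree_adjacency_matrix t G) \<longleftrightarrow>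
    (\<exists>x. (\<exists>i<n. x i \<noteq> 0) \<and> (\<forall>i<n. (\<Sum>w\<in>parcs G `` {i}. t * x i + x w) = \<mu> * x i))"
  using eigenvalue_iff_eigenfunction[OF degree_adjacency_matrix_carrier[OF G]]
  by (simp add: spectrum_def degree_adjacency_matrix_row_sum[OF G])

lemma largest_eigenvalue_in_spectrum:
  assumes "G \<in> graphs_of_order n" "0 < n"
  shows "largest_eigenvalue (degree_adjacency_matrix t G) \<in> spectrum (degree_adjacency_matrix t G)"
  unfolding largest_eigenvalue_def
proof (rule Max_in)
  note carrier = degree_adjacency_matrix_carrier[OF assms(1)]
  show "finite (spectrum (degree_adjacency_matrix t G))" by (rule card_finite_spectrum(1)[OF carrier])
  show "spectrum (degree_adjacency_matrix t G) \<noteq> {}"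
    using graphs_of_orderD(3)[OF assms(1)]
    by (intro symmetric_real_spectrum_nonempty[OF carrier assms(2)])
      (auto simp: degree_adjacency_matrix_index[OF assms(1)] dest: symD)
qed

section \<open>The extremal graphs\<close>

lemma in_shift_graph:
  "v \<in> pverts (shift_graph m G) \<longleftrightarrow> m \<le> v \<and> v - m \<in> pverts G"
  "(u, v) \<in> parcs (shift_graph m G) \<longleftrightarrow> m \<le> u \<and> m \<le> v \<and> (u - m, v - m) \<in> parcs G"
  by (force simp: shift_graph_def image_iff le_iff_add)+

text \<open>The shifts in join and union place the dominating clique first, then the
  \<open>s\<close> independent vertices, then the other clique. The bound on \<open>n\<close> keeps
  the subtraction \<open>n - 2 * s - 1\<close> from being truncated.\<close>

lemma R_graph_eq:
  assumes "2 * s + 1 \<le> n"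
  shows "R_graph n s = \<lparr>pverts = {0..<n},
    parcs = threshold_arcs {s + 1..<2 * s + 1} {2 * s + 1..<n} {0..<s + 1}\<rparr>"
proof (rule pair_pre_digraph.equality)
  have card: "card (pverts (complete_graph m)) = m" "card (pverts (empty_graph m)) = m" for m
    by (simp_all add: complete_graph_def empty_graph_def)
  have K: "v \<in> pverts (complete_graph m) \<longleftrightarrow> v < m"
    "(u, v) \<in> parcs (complete_graph m) \<longleftrightarrow> u < m \<and> v < m \<and> u \<noteq> v"
    "v \<in> pverts (empty_graph m) \<longleftrightarrow> v < m" "parcs (empty_graph m) = {}" for m u v
    by (auto simp: complete_graph_def empty_graph_def)
  obtain m where n: "n = 2 * s + 1 + m" using le_Suc_ex[OF assms] by blast
  have m: "n - 2 * s - 1 = m" by (simp add: n)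
  define D where "D = disjoint_union_graph (empty_graph s) (complete_graph m)"
  have R: "R_graph n s = join_graph (complete_graph (s + 1)) D"
    by (simp only: R_graph_def D_def m)
  have VD: "v \<in> pverts D \<longleftrightarrow> v < s + m" for v
  proof -
    have "v \<in> pverts D \<longleftrightarrow> v < s \<or> s \<le> v \<and> v - s < m"
      by (simp add: D_def disjoint_union_graph_def Let_def card in_shift_graph K)
    thus ?thesis by linarith
  qed
  have ED: "(s + u, s + v) \<in> parcs D \<longleftrightarrow> u < m \<and> v < m \<and> u \<noteq> v" for u v
    by (simp add: D_def disjoint_union_graph_def Let_def card in_shift_graph K)
  have ED': "(u, v) \<in> parcs D \<longrightarrow> s \<le> u \<and> s \<le> v" for u v
    by (simp add: D_def disjoint_union_graph_def Let_def card in_shift_graph K)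
  have V1: "s + 1 \<le> v \<Longrightarrow> v - (s + 1) \<in> pverts D \<longleftrightarrow> v < n" for v
    unfolding VD n by linarith
  have V: "v \<in> pverts (R_graph n s) \<longleftrightarrow> v < n" for v
  proof -
    have "v \<in> pverts (R_graph n s) \<longleftrightarrow> v < s + 1 \<or> s + 1 \<le> v \<and> v < n"
      by (simp add: R join_graph_def Let_def card in_shift_graph K V1 del: One_nat_def cong: conj_cong)
    thus ?thesis unfolding n by linarith
  qed
  have E: "(u, v) \<in> parcs (R_graph n s) \<longleftrightarrow>
    (u, v) \<in> threshold_arcs {s + 1..<2 * s + 1} {2 * s + 1..<n} {0..<s + 1}" for u v
  proof -
    have R_arcs: "(u, v) \<in> parcs (R_graph n s) \<longleftrightarrow>
      u < s + 1 \<and> v < s + 1 \<and> u \<noteq> v \<or>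
      s + 1 \<le> u \<and> s + 1 \<le> v \<and> (u - (s + 1), v - (s + 1)) \<in> parcs D \<or>
      u < s + 1 \<and> s + 1 \<le> v \<and> v < n \<or> s + 1 \<le> u \<and> u < n \<and> v < s + 1"
      by (simp add: R join_graph_def Let_def card in_shift_graph K V1 del: One_nat_def cong: conj_cong)
    have VT: "{s + 1..<2 * s + 1} \<union> {2 * s + 1..<n} \<union> {0..<s + 1} = {0..<n}"
      using assms by auto
    have T: "(u, v) \<in> threshold_arcs {s + 1..<2 * s + 1} {2 * s + 1..<n} {0..<s + 1} \<longleftrightarrow>
      u < n \<and> v < n \<and> u \<noteq> v \<and> (u < s + 1 \<or> v < s + 1 \<or> 2 * s + 1 \<le> u \<and> 2 * s + 1 \<le> v)"
      unfolding threshold_arcs_def VT by auto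
    show ?thesis
    proof (cases "u < s + 1 \<or> v < s + 1")
      case True
      thus ?thesis unfolding R_arcs T using n by linarith
    next
      case False
      hence uv: "s + 1 \<le> u" "s + 1 \<le> v" by simp_all
      show ?thesis
      proof (cases "2 * s + 1 \<le> u \<and> 2 * s + 1 \<le> v")
        case True
        then obtain u' v' where "u = 2 * s + 1 + u'" "v = 2 * s + 1 + v'" using le_Suc_ex by blast
        moreover from this have "u - (s + 1) = s + u'" "v - (s + 1) = s + v'" by simp_all
        ultimately show ?thesis unfolding R_arcs T using uv ED[of u' v'] by (simp add: n)
      next
        case False
        hence "(u - (s + 1), v - (s + 1)) \<notin> parcs D"
          using ED'[of "u - (s + 1)" "v - (s + 1)"] uv by linarith
        thus ?thesis unfolding R_arcs T using uv False by linarith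
      qed
    qed
  qed
  show "pverts (R_graph n s) = pverts \<lparr>pverts = {0..<n},
    parcs = threshold_arcs {s + 1..<2 * s + 1} {2 * s + 1..<n} {0..<s + 1}\<rparr>"
    by (rule Set.set_eqI) (simp add: V)
  show "parcs (R_graph n s) = parcs \<lparr>pverts = {0..<n},
    parcs = threshold_arcs {s + 1..<2 * s + 1} {2 * s + 1..<n} {0..<s + 1}\<rparr>"
    by (rule Set.set_eqI, rename_tac e, case_tac e) (simp only: E pair_pre_digraph.select_convs)
qed simp_all

lemma R_graph_in_graphs_of_order:
  assumes "2 * s + 1 \<le> n"
  shows "R_graph n s \<in> graphs_of_order n"
proof -
  have "{s + 1..<2 * s + 1} \<union> {2 * s + 1..<n} \<union> {0..<s + 1} = {0..<n}" using assms by auto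
  hence "threshold_arcs {s + 1..<2 * s + 1} {2 * s + 1..<n} {0..<s + 1} \<subseteq> {0..<n} \<times> {0..<n}"
    using threshold_arcs_subset by metis
  thus ?thesis
    by (simp add: graphs_of_order_def pair_graph_iff R_graph_eq[OF assms] sym_threshold_arcs
        irrefl_threshold_arcs)
qed

section \<open>Isomorphism of threshold graphs\<close>

lemma digraph_isoI:
  assumes "pair_wf_digraph G" "bij_betw \<phi> (pverts G) (pverts H)" "parcs H \<subseteq> pverts H \<times> pverts H"
    and arcs: "\<And>u v. u \<in> pverts G \<Longrightarrow> v \<in> pverts G \<Longrightarrow> (\<phi> u, \<phi> v) \<in> parcs H \<longleftrightarrow> (u, v) \<in> parcs G"
  shows "digraph_iso (with_proj G) (with_proj H)"
proof -
  interpret pair_wf_digraph G by fact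
  let ?h = "\<lparr>iso_verts = \<phi>, iso_arcs = map_prod \<phi> \<phi>, iso_head = snd, iso_tail = fst\<rparr>"
  have inj: "inj_on \<phi> (pverts G)" and im: "\<phi> ` pverts G = pverts H"
    using assms(2) by (auto simp: bij_betw_def)
  have "inj_on (map_prod \<phi> \<phi>) (parcs G)"
    by (rule inj_on_subset[OF map_prod_inj_on[OF inj inj]]) (auto dest: wellformed')
  hence iso: "pre_digraph.digraph_isomorphism (with_proj G) ?h"
    unfolding pre_digraph.digraph_isomorphism_def using inj assms(1)
    by (auto simp: wf_digraph_wp_iff)
  have "parcs H = map_prod \<phi> \<phi> ` parcs G"
  proof (intro Set.set_eqI iffI)
    fix e assume e: "e \<in> parcs H"
    then obtain u v where "u \<in> pverts G" "v \<in> pverts G" "e = (\<phi> u, \<phi> v)"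
      using assms(3) im by (cases e) blast
    thus "e \<in> map_prod \<phi> \<phi> ` parcs G" using arcs e by force
  next
    fix e assume "e \<in> map_prod \<phi> \<phi> ` parcs G"
    thus "e \<in> parcs H" using arcs by (auto dest: wellformed')
  qed
  hence "with_proj H = app_iso ?h (with_proj G)"
    by (simp add: app_iso_def with_proj_def im)
  with iso show ?thesis unfolding digraph_iso_def by blast
qed

text \<open>Adjacency depends only on the parts containing the two vertices, so any bijections
  between corresponding parts glue to an isomorphism.\<close>

lemma threshold_arcs_bij:
  assumes "finite S" "finite T" "finite W" "finite S'" "finite T'" "finite W'"
    and "card S = card S'" "card T = card T'" "card W = card W'"
    and "S \<inter> T = {}" "S \<inter> W = {}" "T \<inter> W = {}" "S' \<inter> T' = {}" "S' \<inter> W' = {}" "T' \<inter> W' = {}"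
  obtains \<phi> where "bij_betw \<phi> (S \<union> T \<union> W) (S' \<union> T' \<union> W')"
    "\<And>u v. u \<in> S \<union> T \<union> W \<Longrightarrow> v \<in> S \<union> T \<union> W \<Longrightarrow>
      (\<phi> u, \<phi> v) \<in> threshold_arcs S' T' W' \<longleftrightarrow> (u, v) \<in> threshold_arcs S T W"
proof -
  obtain f g h where f: "bij_betw f S S'" and g: "bij_betw g T T'" and h: "bij_betw h W W'"
    using finite_same_card_bij[OF assms(1,4,7)] finite_same_card_bij[OF assms(2,5,8)]
      finite_same_card_bij[OF assms(3,6,9)] by blast
  define \<phi> where "\<phi> v = (if v \<in> S then f v else if v \<in> T then g v else h v)" for v
  have S: "bij_betw \<phi> S S'"
    using f by (subst bij_betw_cong[of S \<phi> f]) (auto simp: \<phi>_def)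
  have T: "bij_betw \<phi> T T'"
    using g assms(10) by (subst bij_betw_cong[of T \<phi> g]) (auto simp: \<phi>_def)
  have W: "bij_betw \<phi> W W'"
    using h assms(11,12) by (subst bij_betw_cong[of W \<phi> h]) (auto simp: \<phi>_def)
  have bij: "bij_betw \<phi> (S \<union> T \<union> W) (S' \<union> T' \<union> W')"
    by (intro bij_betw_combine S T W) (use assms(13-15) in auto)
  have mem: "\<phi> v \<in> S' \<longleftrightarrow> v \<in> S" "\<phi> v \<in> T' \<longleftrightarrow> v \<in> T" "\<phi> v \<in> W' \<longleftrightarrow> v \<in> W"
    if v: "v \<in> S \<union> T \<union> W" for v
  proof -
    have im: "v \<in> S \<Longrightarrow> \<phi> v \<in> S'" "v \<in> T \<Longrightarrow> \<phi> v \<in> T'" "v \<in> W \<Longrightarrow> \<phi> v \<in> W'"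
      using bij_betwE[OF S] bij_betwE[OF T] bij_betwE[OF W] by simp_all
    show "\<phi> v \<in> S' \<longleftrightarrow> v \<in> S" "\<phi> v \<in> T' \<longleftrightarrow> v \<in> T" "\<phi> v \<in> W' \<longleftrightarrow> v \<in> W"
      using v im assms(10-15) by (auto simp: disjoint_iff)
  qed
  have inj: "\<phi> u = \<phi> v \<longleftrightarrow> u = v" if "u \<in> S \<union> T \<union> W" "v \<in> S \<union> T \<union> W" for u v
    using bij that by (auto simp: bij_betw_def inj_on_def)
  show thesis
  proof (rule that[OF bij])
    fix u v assume uv: "u \<in> S \<union> T \<union> W" "v \<in> S \<union> T \<union> W"
    hence "\<phi> u \<in> S' \<union> T' \<union> W'" "\<phi> v \<in> S' \<union> T' \<union> W'" using bij_betwE[OF bij] by blast+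
    thus "(\<phi> u, \<phi> v) \<in> threshold_arcs S' T' W' \<longleftrightarrow> (u, v) \<in> threshold_arcs S T W"
      unfolding threshold_arcs_def mem_Collect_eq prod.case
      using uv mem[OF uv(1)] mem[OF uv(2)] inj[OF uv] by simp
  qed
qed

text \<open>The weights of \<open>R_graph n s\<close> are carried to \<open>G\<close> along the
  partition \<open>S\<close>, \<open>T\<close>, \<open>W\<close>. They form a supersolution there,
  strict wherever a neighbourhood differs from the threshold pattern. In the equality case every
  neighbourhood must follow the pattern.\<close>

lemma threshold_comparison:
  assumes G: "G \<in> graphs_of_order n" and "1 \<le> s" "2 * s + 2 \<le> n" "0 \<le> t"
    and V: "S \<union> T \<union> W = {0..<n}" and disj: "S \<inter> T = {}" "S \<inter> W = {}" "T \<inter> W = {}"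
    and card: "card S = s" "card T = n - 2 * s - 1" "card W = s + 1"
    and degS: "\<And>v. v \<in> S \<Longrightarrow> card (parcs G `` {v}) \<le> s + 1"
    and degT: "\<And>v. v \<in> T \<Longrightarrow> card (parcs G `` {v}) \<le> n - s - 1"
  defines "\<Lambda> \<equiv> \<lambda>G. largest_eigenvalue (degree_adjacency_matrix t G)"
  shows "\<Lambda> G \<le> \<Lambda> (R_graph n s)"
    and "\<Lambda> G = \<Lambda> (R_graph n s) \<Longrightarrow> digraph_iso (with_proj G) (with_proj (R_graph n s))"
proof -
  have n: "2 * s + 1 \<le> n" using assms(3) by simp
  have "1 \<le> real s" "2 * real s + 2 \<le> real n" using assms(2,3) by linarith+
  from this assms(4) obtain \<rho> a b where ab: "0 < a" "a \<le> b" "2 * real s + 2 < real n \<longrightarrow> a < b" "b < 1"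
    and eqs: "t * (real s + 1) * a + (real s + 1) = \<rho> * a"
    "t * (real n - real s - 1) * b + (real s + 1) + (real n - 2 * real s - 2) * b = \<rho> * b"
    "t * (real n - 1) + real s + real s * a + (real n - 2 * real s - 1) * b = \<rho>"
    by (rule threshold_positive_solution)
  define f where "f S T v = (if v \<in> S then a else if v \<in> T then b else 1)" for S T and v :: nat
  have f0: "0 < f S T v" for S T v using ab by (auto simp: f_def)
  define S' T' W' where "S' = {s + 1..<2 * s + 1}" and "T' = {2 * s + 1..<n}" and "W' = {0..<s + 1}"
  note defs' = S'_def T'_def W'_def
  have V': "S' \<union> T' \<union> W' = {0..<n}" using n by (auto simp: defs')
  have disj': "S' \<inter> T' = {}" "S' \<inter> W' = {}" "T' \<inter> W' = {}" by (auto simp: defs')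
  have card': "card S' = s" "card T' = n - 2 * s - 1" "card W' = s + 1" by (auto simp: defs')
  have fin': "finite S'" "finite T'" "finite W'" by (auto simp: defs')
  have R: "R_graph n s \<in> graphs_of_order n" by (rule R_graph_in_graphs_of_order[OF n])
  have arcsR: "parcs (R_graph n s) = threshold_arcs S' T' W'"
    by (simp add: R_graph_eq[OF n] defs')
  have eigR: "(\<Sum>w\<in>parcs (R_graph n s) `` {v}. t * f S' T' v + f S' T' w) = \<rho> * f S' T' v"
    if "v < n" for v
    unfolding arcsR f_def
    by (rule threshold_supersolution(1)[OF fin' disj' card' assms(2-4) ab eqs])
      (use that V' in auto)
  \<comment> \<open>A positive eigenfunction belongs to the largest eigenvalue:
    \<open>eigenfunction_bound\<close> is applied with \<open>R_graph n s\<close> itself as the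
    graph.\<close>
  have LR: "\<Lambda> (R_graph n s) = \<rho>"
    unfolding \<Lambda>_def largest_eigenvalue_def
  proof (rule Max_eqI)
    show "finite (spectrum (degree_adjacency_matrix t (R_graph n s)))"
      by (rule card_finite_spectrum(1)[OF degree_adjacency_matrix_carrier[OF R]])
    have nz: "\<exists>i<n. f S' T' i \<noteq> 0" using f0[of S' T' 0] n by (intro exI[of _ 0]) auto
    show "\<rho> \<in> spectrum (degree_adjacency_matrix t (R_graph n s))"
      unfolding in_spectrum_iff_eigenfunction[OF R] using eigR nz
      by (intro exI[of _ "f S' T'"]) blast
    fix \<mu> assume "\<mu> \<in> spectrum (degree_adjacency_matrix t (R_graph n s))"
    then obtain x i where x: "i < n" "x i \<noteq> 0"
      "\<And>i. i < n \<Longrightarrow> (\<Sum>w\<in>parcs (R_graph n s) `` {i}. t * x i + x w) = \<mu> * x i"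
      unfolding in_spectrum_iff_eigenfunction[OF R] by blast
    show "\<mu> \<le> \<rho>"
      by (rule eigenfunction_bound(1)[of "{0..<n}" "parcs (R_graph n s)" t "f S' T'" \<rho> x \<mu> i])
        (use x eigR f0 assms(4) graphs_of_orderD[OF R] in auto)
  qed
  have fin: "finite S" "finite T" "finite W" using V by (auto intro: finite_subset[of _ "{0..<n}"])
  note Gd = graphs_of_orderD[OF G]
  let ?f = "f S T"
  have eq: "(\<Sum>w\<in>threshold_arcs S T W `` {v}. t * ?f v + ?f w) = \<rho> * ?f v" if "v < n" for v
    unfolding f_def
    by (rule threshold_supersolution(1)[OF fin disj card assms(2-4) ab eqs])
      (use that V in auto)
  have strict: "(\<Sum>w\<in>parcs G `` {v}. t * ?f v + ?f w) < \<rho> * ?f v"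
    if "v < n" "parcs G `` {v} \<noteq> threshold_arcs S T W `` {v}" for v
    unfolding f_def
    by (rule threshold_supersolution(2)[OF fin disj card assms(2-4) ab eqs])
      (use that V Gd degS degT in auto)
  have super: "(\<Sum>w\<in>parcs G `` {v}. t * ?f v + ?f w) \<le> \<rho> * ?f v" if "v < n" for v
    using eq[OF that] strict[OF that] by (cases "parcs G `` {v} = threshold_arcs S T W `` {v}") auto
  have "0 < n" using n by simp
  have "\<Lambda> G \<in> spectrum (degree_adjacency_matrix t G)"
    unfolding \<Lambda>_def by (rule largest_eigenvalue_in_spectrum[OF G \<open>0 < n\<close>])
  then obtain x z where z: "z < n" "x z \<noteq> 0"
    and eig: "\<And>i. i < n \<Longrightarrow> (\<Sum>w\<in>parcs G `` {i}. t * x i + x w) = \<Lambda> G * x i"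
    unfolding in_spectrum_iff_eigenfunction[OF G] by blast
  have prem: "finite {0..<n}" "\<And>v. v \<in> {0..<n} \<Longrightarrow> 0 < ?f v"
    "\<And>v. v \<in> {0..<n} \<Longrightarrow> (\<Sum>w\<in>parcs G `` {v}. t * ?f v + ?f w) \<le> \<rho> * ?f v"
    "\<And>v. v \<in> {0..<n} \<Longrightarrow> (\<Sum>w\<in>parcs G `` {v}. t * x v + x w) = \<Lambda> G * x v"
    "z \<in> {0..<n}"
    using f0 super eig z by auto
  note bound = eigenfunction_bound[OF prem(1) Gd(3,2) assms(4) prem(2-5) z(2)]
  show "\<Lambda> G \<le> \<Lambda> (R_graph n s)" unfolding LR by (rule bound(1))
  assume "\<Lambda> G = \<Lambda> (R_graph n s)"
  hence L: "\<Lambda> G = \<rho>" by (simp add: LR)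
  have nbr: "parcs G `` {v} = threshold_arcs S T W `` {v}" if "v < n" "x v \<noteq> 0" for v
  proof -
    have "(\<Sum>w\<in>parcs G `` {v}. t * ?f v + ?f w) = \<rho> * ?f v"
      by (rule bound(2)) (use L that in auto)
    thus ?thesis using strict[OF that(1)] by linarith
  qed
  have closed: "x w \<noteq> 0" if "(v, w) \<in> parcs G" "x v \<noteq> 0" for v w
    by (rule bound(3)) (use L that in auto)
  have "W \<noteq> {}" using card by auto
  \<comment> \<open>From any support vertex the support reaches \<open>W\<close>, because outside
    \<open>W\<close> the pattern joins a vertex to all of \<open>W\<close>; from a vertex of
    \<open>W\<close> it then reaches every vertex.\<close>
  have "\<exists>c\<in>W. x c \<noteq> 0"
  proof (cases "z \<in> W")
    case True
    thus ?thesis using z by blast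
  next
    case False
    hence "W \<subseteq> parcs G `` {z}"
      using z V unfolding nbr[OF z] by (auto simp: threshold_arcs_def)
    thus ?thesis using \<open>W \<noteq> {}\<close> closed z by blast
  qed
  then obtain c where c: "c \<in> W" "x c \<noteq> 0" by blast
  have "c < n" using c V by auto
  have nz: "x v \<noteq> 0" if "v < n" for v
  proof (cases "v = c")
    case False
    hence "v \<in> parcs G `` {c}"
      using c V that unfolding nbr[OF \<open>c < n\<close> c(2)] by (auto simp: threshold_arcs_def)
    thus ?thesis using closed c by blast
  qed (use c in simp)
  have arcsG: "parcs G = threshold_arcs S T W"
  proof (intro Set.set_eqI iffI)
    fix e assume "e \<in> parcs G"
    moreover from this obtain u v where "e = (u, v)" "u < n" using Gd(2) by auto
    ultimately show "e \<in> threshold_arcs S T W" using nbr[of u] nz by auto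
  next
    fix e assume "e \<in> threshold_arcs S T W"
    moreover from this obtain u v where "e = (u, v)" "u < n"
      using V by (auto simp: threshold_arcs_def)
    ultimately show "e \<in> parcs G" using nbr[of u] nz by auto
  qed
  obtain \<phi> where "bij_betw \<phi> (S \<union> T \<union> W) (S' \<union> T' \<union> W')"
    "\<And>u v. u \<in> S \<union> T \<union> W \<Longrightarrow> v \<in> S \<union> T \<union> W \<Longrightarrow>
      (\<phi> u, \<phi> v) \<in> threshold_arcs S' T' W' \<longleftrightarrow> (u, v) \<in> threshold_arcs S T W"
    by (rule threshold_arcs_bij[OF fin fin' _ _ _ disj disj']) (auto simp: card card')
  moreover have "pair_wf_digraph G"
    using G by (auto simp: graphs_of_order_def pair_graph_def pair_digraph_def pair_fin_digraph_def)
  ultimately show "digraph_iso (with_proj G) (with_proj (R_graph n s))"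
    using graphs_of_orderD[OF R]
    by (intro digraph_isoI[of _ \<phi>]) (auto simp: V V' Gd(1) arcsG arcsR)
qed

section \<open>Hamilton-connectedness and minimum degree\<close>

lemma hamiltonian_connected_iff:
  "hamiltonian_connected G \<longleftrightarrow> (\<forall>u\<in>pverts G. \<forall>v\<in>pverts G. u \<noteq> v \<longrightarrow>
    (\<exists>p. hamilton_path (pverts G) (parcs G) u v p))"
proof -
  have "set (vwalk_arcs p) \<subseteq> E \<longleftrightarrow> successively (\<lambda>a b. (a, b) \<in> E) p" for p and E :: "nat rel"
    by (induction p rule: vwalk_arcs.induct) auto
  hence "vpath p (with_proj G) \<and> hd p = u \<and> last p = v \<and> set p = pverts G \<longleftrightarrow>
      hamilton_path (pverts G) (parcs G) u v p" for p u v
    unfolding vpath_def vwalk_def hamilton_path_def by auto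
  thus ?thesis by (simp add: hamiltonian_connected_def)
qed

lemma le_min_degree_iff:
  assumes "G \<in> graphs_of_order n" "0 < n"
  shows "k \<le> min_degree G \<longleftrightarrow> (\<forall>v<n. k \<le> card (parcs G `` {v}))"
  unfolding min_degree_def graphs_of_orderD(1)[OF assms(1)] out_degree_eq_card_Image
  using assms(2) by (subst Min_ge_iff) auto

text \<open>
  The vertices of \<open>S\<close> together with the last vertex of \<open>T\<close> are all followed on the path by
  vertices of \<open>W\<close> other than \<open>x\<close>, and there are too few of these.
\<close>

lemma threshold_arcs_no_hamilton_path:
  assumes "finite S" "finite T" "finite W"
    and disj: "S \<inter> T = {}" "S \<inter> W = {}" "T \<inter> W = {}"
    and "T \<noteq> {}" "card W \<le> card S + 1" "x \<in> W" "y \<in> W"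
  shows "\<not> hamilton_path (S \<union> T \<union> W) (threshold_arcs S T W) x y p"
proof
  let ?X = "threshold_arcs S T W"
  assume p: "hamilton_path (S \<union> T \<union> W) ?X x y p"
  define n where "n = length p"
  have ne: "p \<noteq> []" and dist: "distinct p" and set: "set p = S \<union> T \<union> W"
    using p by (auto simp: hamilton_path_def)
  have first: "p ! 0 = x" and last: "p ! (n - 1) = y"
    using p ne by (auto simp: hamilton_path_def hd_conv_nth last_conv_nth n_def)
  have inj: "p ! i = p ! j \<longleftrightarrow> i = j" if "i < n" "j < n" for i j
    using dist that by (simp add: nth_eq_iff_index_eq n_def)
  have arc: "(p ! j, p ! Suc j) \<in> ?X" if "Suc j < n" for j
    using p that by (auto simp: hamilton_path_def successively_conv_nth n_def)
  define K where "K = {j. j < n \<and> p ! j \<in> T}"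
  define m where "m = Max K"
  have finK: "finite K" by (rule finite_subset[of _ "{..<n}"]) (auto simp: K_def)
  obtain z where z: "z \<in> T" using \<open>T \<noteq> {}\<close> by blast
  hence "z \<in> set p" using set by blast
  hence "K \<noteq> {}" using z by (auto simp: K_def in_set_conv_nth n_def)
  hence "m \<in> K" and max: "\<And>j. j \<in> K \<Longrightarrow> j \<le> m" using finK by (auto simp: m_def)
  hence m: "m < n" "p ! m \<in> T" by (auto simp: K_def)
  define J where "J = {j. j < n \<and> p ! j \<in> S}"
  have finJ: "finite J" by (rule finite_subset[of _ "{..<n}"]) (auto simp: J_def)
  have "S \<subseteq> (!) p ` J"
  proof
    fix w assume w: "w \<in> S"
    hence "w \<in> set p" using set by blast
    thus "w \<in> (!) p ` J" using w by (auto simp: J_def in_set_conv_nth n_def)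
  qed
  hence "card S \<le> card J" using finJ by (rule surj_card_le[rotated])
  moreover have "m \<notin> J" using m disj(1) by (auto simp: J_def)
  ultimately have card: "card S + 1 \<le> card (insert m J)" using finJ by simp
  have Suc: "Suc j < n" if "j \<in> insert m J" for j
  proof -
    have "j < n" "p ! j \<in> S \<union> T" using that m by (auto simp: J_def)
    moreover from this(2) have "j \<noteq> n - 1" using last disj(2,3) \<open>y \<in> W\<close> by auto
    ultimately show ?thesis by linarith
  qed
  have "(\<lambda>j. p ! Suc j) ` insert m J \<subseteq> W - {x}"
  proof
    fix w assume "w \<in> (\<lambda>j. p ! Suc j) ` insert m J"
    then obtain j where j: "j \<in> insert m J" "w = p ! Suc j" by blast
    have "w \<noteq> x" using inj[of "Suc j" 0] Suc[OF j(1)] first j(2) by auto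
    moreover have "w \<in> W"
    proof (cases "j = m")
      case True
      \<comment> \<open>Position \<open>m\<close> is the last one in \<open>T\<close>, so its
        successor is outside \<open>T\<close>, and an arc leaving \<open>T\<close> ends in
        \<open>W\<close>.\<close>
      have "Suc m \<notin> K" using max[of "Suc m"] by auto
      hence "w \<notin> T" using Suc[OF j(1)] j(2) True by (auto simp: K_def)
      thus ?thesis using arc[OF Suc[OF j(1)]] m(2) j(2) True disj by (auto simp: threshold_arcs_def)
    next
      case False
      hence "p ! j \<in> S" using j(1) by (auto simp: J_def)
      thus ?thesis using arc[OF Suc[OF j(1)]] j(2) disj by (auto simp: threshold_arcs_def)
    qed
    ultimately show "w \<in> W - {x}" by blast
  qed
  moreover have "inj_on (\<lambda>j. p ! Suc j) (insert m J)"
    by (rule inj_onI) (use inj[OF Suc Suc] in simp)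
  ultimately have "card (insert m J) \<le> card (W - {x})"
    using card_inj_on_le[of _ "insert m J" "W - {x}"] \<open>finite W\<close> by blast
  also have "\<dots> < card W" using \<open>finite W\<close> \<open>x \<in> W\<close> by (intro psubset_card_mono) auto
  finally show False using card assms(8) by linarith
qed

lemma R_graph_in_non_property_graphs:
  assumes "2 \<le> k" "k \<le> s + 1" "2 * s + 2 \<le> n"
  shows "R_graph n s \<in> non_property_graphs n hamiltonian_connected k"
proof -
  define S T W where "S = {s + 1..<2 * s + 1}" and "T = {2 * s + 1..<n}" and "W = {0..<s + 1}"
  have fin: "finite S" "finite T" "finite W" by (simp_all add: S_def T_def W_def)
  have disj: "S \<inter> T = {}" "S \<inter> W = {}" "T \<inter> W = {}" by (auto simp: S_def T_def W_def)
  have V: "S \<union> T \<union> W = {0..<n}" using assms(3) by (auto simp: S_def T_def W_def)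
  have n: "2 * s + 1 \<le> n" "0 < n" using assms(3) by simp_all
  note R = R_graph_in_graphs_of_order[OF n(1)]
  have arcs: "parcs (R_graph n s) = threshold_arcs S T W" "pverts (R_graph n s) = S \<union> T \<union> W"
    unfolding V by (simp_all add: R_graph_eq[OF n(1)] S_def T_def W_def)
  have "k \<le> card (parcs (R_graph n s) `` {v})" if v: "v < n" for v
  proof -
    have "v \<in> S \<union> T \<union> W" unfolding V using v by simp
    then consider "v \<in> S \<union> T" | "v \<in> W" by blast
    hence "s + 1 \<le> card (threshold_arcs S T W `` {v})"
    proof cases
      case 1
      hence "W \<subseteq> threshold_arcs S T W `` {v}"
        using disj by (auto simp: threshold_arcs_def)
      moreover have "finite (threshold_arcs S T W `` {v})"
        by (rule finite_subset[of _ "S \<union> T \<union> W"]) (use fin in \<open>auto simp: threshold_arcs_def\<close>)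
      ultimately have "card W \<le> card (threshold_arcs S T W `` {v})" by (rule card_mono[rotated])
      thus ?thesis by (simp add: W_def)
    next
      case 2
      have "card (threshold_arcs S T W `` {v}) = n - 1"
        unfolding threshold_arcs_Image(3)[OF disj 2] V using v by simp
      thus ?thesis using assms(3) by linarith
    qed
    thus ?thesis unfolding arcs using assms(2) by linarith
  qed
  hence "k \<le> min_degree (R_graph n s)" unfolding le_min_degree_iff[OF R n(2)] by simp
  moreover have "\<not> hamiltonian_connected (R_graph n s)"
  proof -
    \<comment> \<open>Both ends are taken in \<open>W\<close>, which has two vertices because
      \<open>k \<ge> 2\<close> forces \<open>s \<ge> 1\<close>.\<close>
    have "0 \<in> W" "1 \<in> W" using assms by (auto simp: W_def)
    moreover have "T \<noteq> {}" using assms by (auto simp: T_def)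
    moreover have "card W \<le> card S + 1" by (simp add: S_def W_def)
    ultimately have none: "\<nexists>p. hamilton_path (S \<union> T \<union> W) (threshold_arcs S T W) 0 1 p"
      using threshold_arcs_no_hamilton_path[OF fin disj] by blast
    show ?thesis
    proof
      assume "hamiltonian_connected (R_graph n s)"
      hence all: "\<forall>u\<in>S \<union> T \<union> W. \<forall>v\<in>S \<union> T \<union> W. u \<noteq> v \<longrightarrow>
          (\<exists>p. hamilton_path (S \<union> T \<union> W) (threshold_arcs S T W) u v p)"
        by (simp only: hamiltonian_connected_iff arcs)
      have "0 \<in> S \<union> T \<union> W" "1 \<in> S \<union> T \<union> W" using \<open>0 \<in> W\<close> \<open>1 \<in> W\<close> by simp_all
      from all[rule_format, OF this zero_neq_one] none show False by (rule notE[rotated])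
    qed
  qed
  ultimately show ?thesis using R by (simp add: non_property_graphs_def)
qed

text \<open>The degree counts with \<open>h = s + 1\<close> provide the parts: \<open>S\<close> from
  vertices of degree at most \<open>h\<close>, \<open>T\<close> from the remaining vertices of
  degree at most \<open>n - h\<close>, and \<open>W\<close> from what is left.\<close>

lemma non_hamiltonian_connected_comparison:
  assumes "2 \<le> k" "2 * k \<le> n" and G: "G \<in> non_property_graphs n hamiltonian_connected k"
    and "0 \<le> t"
  defines "\<Lambda> \<equiv> \<lambda>G. largest_eigenvalue (degree_adjacency_matrix t G)"
  obtains s where "s \<in> {k - 1..n div 2 - 1}" "\<Lambda> G \<le> \<Lambda> (R_graph n s)"
    "\<Lambda> G = \<Lambda> (R_graph n s) \<longrightarrow> digraph_iso (with_proj G) (with_proj (R_graph n s))"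
proof -
  have n0: "0 < n" using assms(1,2) by simp
  have G': "G \<in> graphs_of_order n" "k \<le> min_degree G" "\<not> hamiltonian_connected G"
    using G by (auto simp: non_property_graphs_def)
  note Gd = graphs_of_orderD[OF G'(1)]
  let ?d = "\<lambda>v. card (parcs G `` {v})" and ?V = "{0..<n}"
  have deg: "k \<le> ?d v" if "v < n" for v using le_min_degree_iff[OF G'(1) n0] G'(2) that by blast
  obtain x y where xy: "x \<in> ?V" "y \<in> ?V" "x \<noteq> y" "\<nexists>p. hamilton_path ?V (parcs G) x y p"
    using G'(3) unfolding hamiltonian_connected_iff Gd(1) by blast
  obtain h u where h: "2 * h \<le> card ?V" "u \<in> ?V" "?d u \<le> h"
    "h \<le> Suc (card {w \<in> ?V. ?d w \<le> h})"
    "card ?V - h \<le> card {w \<in> ?V. ?d w \<le> card ?V - h}"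
    by (rule no_hamilton_path_degrees[OF finite_atLeastLessThan xy(1-3) Gd(3,4,2) xy(4)])
  \<comment> \<open>Here the minimum degree enters, through the vertex \<open>u\<close>; it yields
    \<open>k - 1 \<le> s\<close>.\<close>
  have "k \<le> h" using deg[of u] h(2,3) by simp
  define s where "s = h - 1"
  have hs: "h = s + 1" using \<open>k \<le> h\<close> assms(1) by (simp add: s_def)
  have s: "1 \<le> s" "2 * s + 2 \<le> n" "k - 1 \<le> s" "s \<le> n div 2 - 1"
    using \<open>k \<le> h\<close> assms(1) h(1) by (auto simp: hs)
  have "s \<le> card {w \<in> ?V. ?d w \<le> h}" using h(4) hs by linarith
  then obtain S where S: "S \<subseteq> {w \<in> ?V. ?d w \<le> h}" "card S = s" "finite S"
    by (rule obtain_subset_with_card_n)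
  \<comment> \<open>Removing \<open>S\<close> costs at most \<open>s\<close> vertices, which leaves
    the \<open>n - 2 * s - 1\<close> required for \<open>T\<close>.\<close>
  have "n - h - s \<le> card ({w \<in> ?V. ?d w \<le> n - h} - S)"
    using h(5) diff_card_le_card_Diff[OF S(3), of "{w \<in> ?V. ?d w \<le> n - h}"] S(2) by simp
  then obtain T where T: "T \<subseteq> {w \<in> ?V. ?d w \<le> n - h} - S" "card T = n - h - s" "finite T"
    by (rule obtain_subset_with_card_n)
  define W where "W = ?V - (S \<union> T)"
  have V: "S \<union> T \<union> W = ?V" using S(1) T(1) by (auto simp: W_def)
  have disj: "S \<inter> T = {}" "S \<inter> W = {}" "T \<inter> W = {}" using T(1) by (auto simp: W_def)
  have "card (S \<union> T) = s + (n - h - s)"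
    using S(2,3) T(2,3) disj(1) by (simp add: card_Un_disjoint)
  moreover have "card W = n - card (S \<union> T)"
    unfolding W_def using V S(3) T(3) by (subst card_Diff_subset) auto
  ultimately have cW: "card W = s + 1" using s(2) by (simp add: hs)
  have cT: "card T = n - 2 * s - 1" using T(2) by (simp add: hs)
  have dS: "\<And>v. v \<in> S \<Longrightarrow> ?d v \<le> s + 1" and dT: "\<And>v. v \<in> T \<Longrightarrow> ?d v \<le> n - s - 1"
    using S(1) T(1) by (auto simp: hs)
  note comparison = threshold_comparison[OF G'(1) s(1,2) assms(4) V disj S(2) cT cW dS dT]
  show thesis
  proof (rule that[of s])
    show "s \<in> {k - 1..n div 2 - 1}" using s by simp
    show "\<Lambda> G \<le> \<Lambda> (R_graph n s)"
      unfolding \<Lambda>_def by (rule comparison(1))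
    show "\<Lambda> G = \<Lambda> (R_graph n s) \<longrightarrow> digraph_iso (with_proj G) (with_proj (R_graph n s))"
      unfolding \<Lambda>_def by (intro impI) (rule comparison(2))
  qed
qed

section \<open>The extremal value and the extremal family\<close>

lemma iso_class_cong:
  assumes "G \<in> graphs_of_order n" "H \<in> graphs_of_order n"
    and "digraph_iso (with_proj G) (with_proj H)"
  shows "iso_class G = iso_class H"
proof -
  have "wf_digraph (with_proj G)"
    using assms(1) unfolding wf_digraph_wp_iff
    by (auto simp: graphs_of_order_def pair_graph_def pair_digraph_def pair_fin_digraph_def)
  hence "digraph_iso (with_proj H) (with_proj G)" using assms(3) by (rule digraph_iso_swap)
  hence "digraph_iso (with_proj G) (with_proj K) \<longleftrightarrow> digraph_iso (with_proj H) (with_proj K)"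
    for K :: "nat pair_pre_digraph"
    using assms(3) digraph_iso_trans by blast
  moreover have "card (pverts G) = card (pverts H)"
    using graphs_of_orderD(1)[OF assms(1)] graphs_of_orderD(1)[OF assms(2)] by simp
  ultimately show ?thesis by (simp add: iso_class_def)
qed

theorem theorem2p8:
  fixes k n :: nat and lam :: "nat pair_pre_digraph \<Rightarrow> real"
  assumes "2 \<le> k" and "2 * k \<le> n"
    and "lam \<in> {adjacency_radius, signless_laplacian_radius}"
  shows "spex lam n hamiltonian_connected k = Max {lam (R_graph n s) | s. s \<in> {k - 1..n div 2 - 1}}
    \<and> SPEX lam n hamiltonian_connected k =
        {iso_class (R_graph n s) | s.
          s \<in> {k - 1..n div 2 - 1} \<and> lam (R_graph n s) = spex lam n hamiltonian_connected k}"
proof -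
  obtain t :: real where "0 \<le> t" and lam: "lam = (\<lambda>G. largest_eigenvalue (degree_adjacency_matrix t G))"
  proof (cases "lam = adjacency_radius")
    case True
    show ?thesis
      by (rule that[of 0]) (use True in \<open>auto simp: adjacency_radius_eq fun_eq_iff\<close>)
  next
    case False
    hence "lam = signless_laplacian_radius" using assms(3) by blast
    thus ?thesis
      by (intro that[of 1]) (auto simp: signless_laplacian_radius_eq fun_eq_iff)
  qed
  let ?N = "non_property_graphs n hamiltonian_connected k" and ?I = "{k - 1..n div 2 - 1}"
  let ?M = "spex lam n hamiltonian_connected k"
  have compare: "\<exists>s\<in>?I. lam G \<le> lam (R_graph n s) \<and>
      (lam G = lam (R_graph n s) \<longrightarrow> digraph_iso (with_proj G) (with_proj (R_graph n s)))"
    if "G \<in> ?N" for G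
    using non_hamiltonian_connected_comparison[OF assms(1,2) that \<open>0 \<le> t\<close>] unfolding lam by blast
  have R: "R_graph n s \<in> ?N" if "s \<in> ?I" for s
    using that assms(1,2) by (intro R_graph_in_non_property_graphs) auto
  have sub: "?N \<subseteq> graphs_of_order n" by (auto simp: non_property_graphs_def)
  have finN: "finite ?N" using sub finite_graphs_of_order by (rule finite_subset)
  have le: "lam G \<le> ?M" if "G \<in> ?N" for G
    unfolding spex_def using finN that by simp
  have eq: "?M = Max {lam (R_graph n s) | s. s \<in> ?I}"
  proof -
    let ?L = "{lam (R_graph n s) | s. s \<in> ?I}"
    have L: "?L = (\<lambda>s. lam (R_graph n s)) ` ?I" by auto
    \<comment> \<open>The range of \<open>s\<close> is nonempty because
      \<open>2 * k \<le> n\<close>.\<close>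
    have "k - 1 \<in> ?I" using assms by auto
    hence "Max ?L \<in> ?L" by (intro Max_in) (auto simp: L)
    hence "Max ?L \<le> ?M" using le R by auto
    moreover have "?M \<le> Max ?L"
      unfolding spex_def
    proof (rule Max.boundedI)
      show "finite (lam ` ?N)" "lam ` ?N \<noteq> {}" using finN R[OF \<open>k - 1 \<in> ?I\<close>] by auto
      fix a assume "a \<in> lam ` ?N"
      then obtain s where "s \<in> ?I" "a \<le> lam (R_graph n s)" using compare by blast
      moreover have "lam (R_graph n s) \<le> Max ?L"
        using \<open>s \<in> ?I\<close> by (intro Max_ge) (auto simp: L)
      ultimately show "a \<le> Max ?L" by simp
    qed
    ultimately show ?thesis by simp
  qed
  have "SPEX lam n hamiltonian_connected k = {iso_class (R_graph n s) | s. s \<in> ?I \<and> lam (R_graph n s) = ?M}"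
    (is "_ = ?C")
  proof (intro equalityI subsetI)
    fix c assume "c \<in> SPEX lam n hamiltonian_connected k"
    then obtain G where G: "G \<in> ?N" "lam G = ?M" "c = iso_class G" by (auto simp: SPEX_def)
    obtain s where s: "s \<in> ?I" "lam G \<le> lam (R_graph n s)"
      "lam G = lam (R_graph n s) \<longrightarrow> digraph_iso (with_proj G) (with_proj (R_graph n s))"
      using compare[OF G(1)] by blast
    \<comment> \<open>\<open>R_graph n s\<close> is itself admissible, so its value lies between
      \<open>lam G = ?M\<close> and \<open>?M\<close>; this equality triggers the isomorphism in
      \<open>compare\<close>.\<close>
    have "lam (R_graph n s) = ?M" using s(2) le[OF R[OF s(1)]] G(2) by simp
    moreover from this have "iso_class G = iso_class (R_graph n s)"
      using s(3) G(1,2) R[OF s(1)] sub by (intro iso_class_cong[of _ n]) auto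
    ultimately show "c \<in> ?C" using s(1) G(3) by auto
  next
    fix c assume "c \<in> ?C"
    then obtain s where "s \<in> ?I" "lam (R_graph n s) = ?M" "c = iso_class (R_graph n s)" by blast
    thus "c \<in> SPEX lam n hamiltonian_connected k" using R by (auto simp: SPEX_def)
  qed
  with eq show ?thesis by blast
qed

end
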